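(* The following statements are equivalent: (1) Each $\mathbb F$-algebra endomorphism of $A$ is an automorphism. (2) Each solvable element in $A$ is strictly nilpotent. (3) Each element in $\Delta_2$ is unsolvable.
   Context: $\mathbb F$ is a field of characteristic zero with algebraic closure $\bar{\mathbb F}$, and $A$ is the (first) Weyl algebra over $\mathbb F$: the associative unital $\mathbb F$-algebra generated by $p,q$ subject to $[p,q]=pq-qp=1$. An element $x\in A$ is called solvable if there is $y\in A$ with $[x,y]=xy-yx=1$, and unsolvable otherwise. For $x\in A$ write $(\mathrm{ad}\,x)y=[x,y]$ and put $N(x)=\{y\in A : (\mathrm{ad}\,x)^n y=0 \text{ for some } n>0\}$, $C(x)=\{y\in A: [x,y]=0\}$, $D(x)=\{y\in A : [x,y]=\lambda y \text{ for some } \lambda\in\bar{\mathbb F}\}$. Let $A-\mathbb F$ be the set of elements of $A$ not in $\mathbb F$, and $\Delta_1=\{x\in A-\mathbb F : N(x)=A,\ D(x)=C(x)\}$, $\Delta_2=\{x\in A-\mathbb F: N(x)\neq A,\ N(x)\neq C(x),\ D(x)=C(x)\}$. An element is strictly nilpotent if it lies in $\Delta_1$. *)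

theory Defs
  imports "HOL-Algebra.Algebraic_Closure_Type" "HOL-Library.Poly_Mapping"
begin

section \<open>The Weyl algebra by generators and relations\<close>

text \<open>
  The free monoid on \<open>p\<close>, \<open>q\<close> is written additively, because \<^typ>\<open>'k \<Rightarrow>\<^sub>0 'a\<close> carries the
  convolution product of the monoid algebra whenever \<^typ>\<open>'k\<close> is an additive monoid. Hence
  \<open>gen_word \<Rightarrow>\<^sub>0 'a\<close> is the free associative unital algebra on \<open>p\<close>, \<open>q\<close>.
\<close>

datatype gen = GenP | GenQ

datatype gen_word = GWord (letters: "gen list")

instantiation gen_word :: monoid_add
begin
definition zero_gen_word :: gen_word where "0 = GWord []"
definition plus_gen_word :: "gen_word \<Rightarrow> gen_word \<Rightarrow> gen_word" where
  "u + v = GWord (letters u @ letters v)"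
instance by standard (simp_all add: zero_gen_word_def plus_gen_word_def)
end

definition free_gen :: "gen \<Rightarrow> gen_word \<Rightarrow>\<^sub>0 'a::field" where
  "free_gen g = Poly_Mapping.single (GWord [g]) 1"

inductive_set weyl_ideal :: "(gen_word \<Rightarrow>\<^sub>0 'a::field) set" where
  relator: "free_gen GenP * free_gen GenQ - free_gen GenQ * free_gen GenP - 1 \<in> weyl_ideal"
| zero: "0 \<in> weyl_ideal"
| add: "x \<in> weyl_ideal \<Longrightarrow> y \<in> weyl_ideal \<Longrightarrow> x + y \<in> weyl_ideal"
| left: "x \<in> weyl_ideal \<Longrightarrow> a * x \<in> weyl_ideal"
| right: "x \<in> weyl_ideal \<Longrightarrow> x * a \<in> weyl_ideal"

definition weyl_eq :: "(gen_word \<Rightarrow>\<^sub>0 'a::field) \<Rightarrow> (gen_word \<Rightarrow>\<^sub>0 'a) \<Rightarrow> bool" where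
  "weyl_eq x y \<longleftrightarrow> x - y \<in> weyl_ideal"

lemma weyl_ideal_uminus: "x \<in> weyl_ideal \<Longrightarrow> - x \<in> weyl_ideal"
  using weyl_ideal.left[of x "- 1"] by simp

lemma weyl_ideal_diff: "x \<in> weyl_ideal \<Longrightarrow> y \<in> weyl_ideal \<Longrightarrow> x - y \<in> weyl_ideal"
  using weyl_ideal.add[OF _ weyl_ideal_uminus, of x y] by simp

lemma equivp_weyl_eq: "equivp (weyl_eq :: (gen_word \<Rightarrow>\<^sub>0 'a::field) \<Rightarrow> _)"
proof (rule equivpI)
  show "reflp (weyl_eq :: (gen_word \<Rightarrow>\<^sub>0 'a) \<Rightarrow> _)" by (rule reflpI) (simp add: weyl_eq_def weyl_ideal.zero)
  show "symp (weyl_eq :: (gen_word \<Rightarrow>\<^sub>0 'a) \<Rightarrow> _)"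
  proof (rule sympI)
    fix x y :: "gen_word \<Rightarrow>\<^sub>0 'a" assume "weyl_eq x y"
    then show "weyl_eq y x" using weyl_ideal_uminus[of "x - y"] by (simp add: weyl_eq_def)
  qed
  show "transp (weyl_eq :: (gen_word \<Rightarrow>\<^sub>0 'a) \<Rightarrow> _)"
  proof (rule transpI)
    fix x y z :: "gen_word \<Rightarrow>\<^sub>0 'a" assume "weyl_eq x y" "weyl_eq y z"
    then show "weyl_eq x z" using weyl_ideal.add[of "x - y" "y - z"] by (simp add: weyl_eq_def)
  qed
qed

lemma poly_mapping_single_induct [case_names zero single_add]:
  fixes x :: "'k \<Rightarrow>\<^sub>0 'b::ab_group_add"
  assumes "Pr 0" and "\<And>k v x. Pr x \<Longrightarrow> Pr (Poly_Mapping.single k v + x)"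
  shows "Pr x"
proof (induction x rule: update_induct)
  case const
  show ?case by (rule assms(1))
next
  case (update f a b)
  have "Poly_Mapping.update a b f = Poly_Mapping.single a b + f"
    using update.hyps
    by (intro poly_mapping_eqI)
       (auto simp: lookup_update lookup_add lookup_single when_def in_keys_iff)
  then show ?case using assms(2) update.IH by simp
qed

text \<open>
  The action on \<open>'a[t]\<close> by \<open>p = d/dt\<close>, \<open>q = t\<close> shows that the quotient is nonzero.
\<close>

fun gen_act :: "gen \<Rightarrow> 'a::field poly \<Rightarrow> 'a poly" where
  "gen_act GenP f = pderiv f"
| "gen_act GenQ f = [:0, 1:] * f"

definition word_act :: "gen_word \<Rightarrow> 'a::field poly \<Rightarrow> 'a poly" where
  "word_act w = foldr gen_act (letters w)"

definition free_act :: "(gen_word \<Rightarrow>\<^sub>0 'a::field) \<Rightarrow> 'a poly \<Rightarrow> 'a poly" where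
  "free_act x f = (\<Sum>w\<in>Poly_Mapping.keys x. smult (Poly_Mapping.lookup x w) (word_act w f))"

lemma gen_act_add: "gen_act g (f + h) = gen_act g f + gen_act g h"
  by (cases g) (simp_all add: pderiv_add algebra_simps)

lemma gen_act_smult: "gen_act g (smult c f) = smult c (gen_act g f)"
  by (cases g) (simp_all add: pderiv_smult)

lemma word_act_add: "word_act w (f + h) = word_act w f + word_act w h"
proof -
  have "foldr gen_act l (f + h) = foldr gen_act l f + foldr gen_act l h" for l
    by (induction l) (simp_all add: gen_act_add)
  then show ?thesis by (simp add: word_act_def)
qed

lemma word_act_smult: "word_act w (smult c f) = smult c (word_act w f)"
proof -
  have "foldr gen_act l (smult c f) = smult c (foldr gen_act l f)" for l
    by (induction l) (simp_all add: gen_act_smult)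
  then show ?thesis by (simp add: word_act_def)
qed

lemma word_act_plus: "word_act (u + v) f = word_act u (word_act v f)"
  by (simp add: word_act_def plus_gen_word_def)

lemma free_act_superset:
  assumes "finite S" "Poly_Mapping.keys x \<subseteq> S"
  shows "free_act x f = (\<Sum>w\<in>S. smult (Poly_Mapping.lookup x w) (word_act w f))"
  unfolding free_act_def using assms by (intro sum.mono_neutral_left) (auto simp: in_keys_iff)

lemma free_act_add: "free_act (x + y) f = free_act x f + free_act y f"
proof -
  let ?S = "Poly_Mapping.keys x \<union> Poly_Mapping.keys y"
  have "Poly_Mapping.keys (x + y) \<subseteq> ?S" by (rule Poly_Mapping.keys_add)
  then show ?thesis
    by (simp add: free_act_superset[of ?S] lookup_add smult_add_left sum.distrib)
qed

lemma free_act_zero [simp]: "free_act 0 f = 0"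
  by (simp add: free_act_def)

lemma free_act_uminus: "free_act (- x) f = - free_act x f"
  using free_act_add[of "- x" x f] by (simp add: eq_neg_iff_add_eq_0)

lemma free_act_diff: "free_act (x - y) f = free_act x f - free_act y f"
  using free_act_add[of x "- y" f] by (simp add: free_act_uminus)

lemma free_act_single: "free_act (Poly_Mapping.single w c) f = smult c (word_act w f)"
  by (simp add: free_act_def)

lemma free_act_one: "free_act 1 f = f"
proof -
  have "word_act 0 f = f" by (simp add: word_act_def zero_gen_word_def)
  then show ?thesis using free_act_single[of 0 1 f] by simp
qed

lemma free_act_add_right: "free_act x (f + h) = free_act x f + free_act x h"
  by (simp add: free_act_def word_act_add smult_add_right sum.distrib)

lemma free_act_zero_right [simp]: "free_act x 0 = 0"
  using free_act_add_right[of x 0 0] by (metis add_cancel_right_right add_0)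

lemma free_act_mult: "free_act (x * y) f = free_act x (free_act y f)"
proof (induction x rule: poly_mapping_single_induct)
  case zero
  show ?case by simp
next
  case (single_add u c x)
  have "free_act (Poly_Mapping.single u c * y) f = free_act (Poly_Mapping.single u c) (free_act y f)"
  proof (induction y rule: poly_mapping_single_induct)
    case zero
    show ?case by simp
  next
    case (single_add v d y)
    then show ?case
      by (simp add: distrib_left free_act_add free_act_add_right mult_single free_act_single
          word_act_smult word_act_plus)
  qed
  with single_add show ?case by (simp add: distrib_right free_act_add)
qed

lemma free_act_ideal: "x \<in> weyl_ideal \<Longrightarrow> free_act x f = 0"
proof (induction arbitrary: f rule: weyl_ideal.induct)
  case relator
  show ?case
    by (simp add: free_act_diff free_act_mult free_act_one free_gen_def free_act_single
        word_act_def pderiv_pCons)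
qed (simp_all add: free_act_add free_act_mult)

lemma one_notin_weyl_ideal: "(1 :: gen_word \<Rightarrow>\<^sub>0 'a::field) \<notin> weyl_ideal"
proof
  assume "(1 :: gen_word \<Rightarrow>\<^sub>0 'a) \<in> weyl_ideal"
  from free_act_ideal[OF this, of 1] show False by (simp add: free_act_one)
qed

quotient_type (overloaded) 'a weyl = "gen_word \<Rightarrow>\<^sub>0 'a::field" / weyl_eq
  by (rule equivp_weyl_eq)

instantiation weyl :: (field) ring_1
begin

lift_definition zero_weyl :: "'a weyl" is 0 .

lift_definition one_weyl :: "'a weyl" is 1 .

lift_definition plus_weyl :: "'a weyl \<Rightarrow> 'a weyl \<Rightarrow> 'a weyl" is "(+)"
proof -
  fix x x' y y' :: "gen_word \<Rightarrow>\<^sub>0 'a"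
  assume "weyl_eq x x'" "weyl_eq y y'"
  then show "weyl_eq (x + y) (x' + y')"
    using weyl_ideal.add[of "x - x'" "y - y'"] by (simp add: weyl_eq_def algebra_simps)
qed

lift_definition uminus_weyl :: "'a weyl \<Rightarrow> 'a weyl" is uminus
proof -
  fix x x' :: "gen_word \<Rightarrow>\<^sub>0 'a"
  assume "weyl_eq x x'"
  then show "weyl_eq (- x) (- x')"
    using weyl_ideal_uminus[of "x - x'"] by (simp add: weyl_eq_def algebra_simps)
qed

lift_definition minus_weyl :: "'a weyl \<Rightarrow> 'a weyl \<Rightarrow> 'a weyl" is "(-)"
proof -
  fix x x' y y' :: "gen_word \<Rightarrow>\<^sub>0 'a"
  assume "weyl_eq x x'" "weyl_eq y y'"
  then show "weyl_eq (x - y) (x' - y')"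
    using weyl_ideal_diff[of "x - x'" "y - y'"] by (simp add: weyl_eq_def algebra_simps)
qed

lift_definition times_weyl :: "'a weyl \<Rightarrow> 'a weyl \<Rightarrow> 'a weyl" is "(*)"
proof -
  fix x x' y y' :: "gen_word \<Rightarrow>\<^sub>0 'a"
  assume "weyl_eq x x'" "weyl_eq y y'"
  then have "(x - x') * y + x' * (y - y') \<in> weyl_ideal"
    by (intro weyl_ideal.add weyl_ideal.left weyl_ideal.right) (simp_all add: weyl_eq_def)
  then show "weyl_eq (x * y) (x' * y')" by (simp add: weyl_eq_def algebra_simps)
qed

instance
proof
  show "(0 :: 'a weyl) \<noteq> 1"
    by transfer (use weyl_ideal_uminus one_notin_weyl_ideal in \<open>fastforce simp: weyl_eq_def\<close>)
qed (transfer; simp add: algebra_simps weyl_eq_def weyl_ideal.zero)+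

end

lift_definition weyl_p :: "'a::field weyl" is "free_gen GenP" .

lift_definition weyl_q :: "'a::field weyl" is "free_gen GenQ" .

lift_definition weyl_scale :: "'a::field \<Rightarrow> 'a weyl \<Rightarrow> 'a weyl"
  is "\<lambda>c x. Poly_Mapping.single 0 c * x"
proof -
  fix c and x x' :: "gen_word \<Rightarrow>\<^sub>0 'a"
  assume "weyl_eq x x'"
  then show "weyl_eq (Poly_Mapping.single 0 c * x) (Poly_Mapping.single 0 c * x')"
    using weyl_ideal.left[of "x - x'"] by (simp add: weyl_eq_def algebra_simps)
qed

global_interpretation weyl: vector_space "weyl_scale :: 'a::field \<Rightarrow> 'a weyl \<Rightarrow> 'a weyl"
proof
  fix a b :: 'a and x y :: "'a weyl"
  show "weyl_scale a (x + y) = weyl_scale a x + weyl_scale a y"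
    by transfer (simp add: distrib_left weyl_eq_def weyl_ideal.zero)
  show "weyl_scale (a + b) x = weyl_scale a x + weyl_scale b x"
    by transfer (simp add: single_add distrib_right weyl_eq_def weyl_ideal.zero)
  show "weyl_scale a (weyl_scale b x) = weyl_scale (a * b) x"
    by transfer (simp add: mult.assoc[symmetric] mult_single weyl_eq_def weyl_ideal.zero)
  show "weyl_scale 1 x = x"
    by transfer (simp add: weyl_eq_def weyl_ideal.zero)
qed

definition weyl_scalars :: "'a::field weyl set" where
  "weyl_scalars = range (\<lambda>c. weyl_scale c 1)"


section \<open>Extension of scalars to the algebraic closure\<close>

text \<open>
  An eigenvalue in the algebraic closure multiplies an element of the Weyl algebra only after
  extension of scalars. The extended algebra is the Weyl algebra over the closure, reached by
  applying \<^const>\<open>to_ac\<close> to coefficients.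
\<close>

definition free_ext :: "(gen_word \<Rightarrow>\<^sub>0 'a::field) \<Rightarrow> gen_word \<Rightarrow>\<^sub>0 'a alg_closure" where
  "free_ext = Poly_Mapping.map to_ac"

lemma lookup_free_ext: "Poly_Mapping.lookup (free_ext x) w = to_ac (Poly_Mapping.lookup x w)"
  by (simp add: free_ext_def Poly_Mapping.map.rep_eq when_def)

lemma free_ext_zero: "free_ext 0 = 0"
  by (rule poly_mapping_eqI) (simp add: lookup_free_ext)

lemma free_ext_add: "free_ext (x + y) = free_ext x + free_ext y"
  by (rule poly_mapping_eqI) (simp add: lookup_free_ext lookup_add)

lemma free_ext_diff: "free_ext (x - y) = free_ext x - free_ext y"
  by (rule poly_mapping_eqI) (simp add: lookup_free_ext lookup_minus)

lemma free_ext_single: "free_ext (Poly_Mapping.single w c) = Poly_Mapping.single w (to_ac c)"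
  by (rule poly_mapping_eqI) (simp add: lookup_free_ext lookup_single when_def)

lemma free_ext_one: "free_ext 1 = 1"
  using free_ext_single[of 0 1] by simp

lemma free_ext_mult: "free_ext (x * y) = free_ext x * free_ext y"
proof (induction x rule: poly_mapping_single_induct)
  case zero
  show ?case by (simp add: free_ext_zero)
next
  case (single_add u c x)
  have "free_ext (Poly_Mapping.single u c * y) = free_ext (Poly_Mapping.single u c) * free_ext y"
  proof (induction y rule: poly_mapping_single_induct)
    case zero
    show ?case by (simp add: free_ext_zero)
  next
    case (single_add v d y)
    then show ?case by (simp add: distrib_left free_ext_add mult_single free_ext_single)
  qed
  with single_add show ?case by (simp add: distrib_right free_ext_add)
qed

lemma free_ext_ideal:
  fixes x :: "gen_word \<Rightarrow>\<^sub>0 'a::field"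
  shows "x \<in> weyl_ideal \<Longrightarrow> free_ext x \<in> weyl_ideal"
proof (induction rule: weyl_ideal.induct)
  case relator
  have "free_ext (free_gen g) = (free_gen g :: gen_word \<Rightarrow>\<^sub>0 'a alg_closure)" for g
    by (simp add: free_gen_def free_ext_single)
  then show ?case
    using weyl_ideal.relator by (simp add: free_ext_diff free_ext_mult free_ext_one)
qed (simp_all add: free_ext_zero free_ext_add free_ext_mult weyl_ideal.intros)

lift_definition weyl_ext :: "'a::field weyl \<Rightarrow> 'a alg_closure weyl" is free_ext
proof -
  fix x y :: "gen_word \<Rightarrow>\<^sub>0 'a"
  assume "weyl_eq x y"
  then show "weyl_eq (free_ext x) (free_ext y)"
    using free_ext_ideal[of "x - y"] by (simp add: weyl_eq_def free_ext_diff)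
qed


section \<open>Solvable and strictly nilpotent elements\<close>

definition ad :: "'b::ring \<Rightarrow> 'b \<Rightarrow> 'b" where
  "ad x y = x * y - y * x"

lemma ad_weyl_p_q: "ad weyl_p weyl_q = 1"
  unfolding ad_def by transfer (simp add: weyl_eq_def weyl_ideal.relator)

definition weyl_solvable :: "'a::field weyl \<Rightarrow> bool" where
  "weyl_solvable x \<longleftrightarrow> (\<exists>y. ad x y = 1)"

definition weyl_N :: "'a::field weyl \<Rightarrow> 'a weyl set" where
  "weyl_N x = {y. \<exists>n>0. (ad x ^^ n) y = 0}"

definition weyl_C :: "'a::field weyl \<Rightarrow> 'a weyl set" where
  "weyl_C x = {y. ad x y = 0}"

definition weyl_D :: "'a::field weyl \<Rightarrow> 'a weyl set" where
  "weyl_D x = {y. \<exists>l :: 'a alg_closure. ad (weyl_ext x) (weyl_ext y) = weyl_scale l (weyl_ext y)}"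

definition Delta1 :: "'a::field weyl set" where
  "Delta1 = {x. x \<notin> weyl_scalars \<and> weyl_N x = UNIV \<and> weyl_D x = weyl_C x}"

definition Delta2 :: "'a::field weyl set" where
  "Delta2 = {x. x \<notin> weyl_scalars \<and> weyl_N x \<noteq> UNIV \<and> weyl_N x \<noteq> weyl_C x \<and> weyl_D x = weyl_C x}"

definition strictly_nilpotent :: "'a::field weyl \<Rightarrow> bool" where
  "strictly_nilpotent x \<longleftrightarrow> x \<in> Delta1"

definition weyl_endomorphism :: "('a::field weyl \<Rightarrow> 'a weyl) \<Rightarrow> bool" where
  "weyl_endomorphism \<phi> \<longleftrightarrow> Vector_Spaces.linear weyl_scale weyl_scale \<phi> \<and> \<phi> 1 = 1 \<and>
    (\<forall>x y. \<phi> (x * y) = \<phi> x * \<phi> y)"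

definition weyl_automorphism :: "('a::field weyl \<Rightarrow> 'a weyl) \<Rightarrow> bool" where
  "weyl_automorphism \<phi> \<longleftrightarrow> weyl_endomorphism \<phi> \<and> bij \<phi>"

end

theory Submission
  imports Defs
begin

text \<open>
  Two mechanisms carry the proof. The first is growth: products of total degree \<open>n\<close> in any fixed
  elements span a space of dimension \<open>O(n\<^sup>2)\<close>, so for any three elements the monomials
  \<open>x\<^sup>i y\<^sup>j z\<^sup>k\<close>, whose number is cubic in the degree bound, are linearly dependent
  (\<open>growth_dependence\<close>). The second is differentiation: if \<open>[x, y] = 1\<close>, then \<open>ad x\<close> acts as
  \<open>d/dy\<close> on polynomials in \<open>y\<close> with coefficients in the centralizer of \<open>x\<close>, so the powers of \<open>y\<close>
  are independent over that centralizer (\<open>slice_independence\<close>), and every element on which \<open>ad x\<close>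
  is nilpotent is such a polynomial (\<open>slice_decomposition\<close>).

  The classes \<open>\<Delta>\<^sub>1\<close> and \<open>\<Delta>\<^sub>2\<close> first. Let \<open>[x, y] = 1\<close>. Then \<open>y \<in> N(x) - C(x)\<close>. If moreover
  \<open>[x, z] = \<lambda> z\<close> with \<open>\<lambda> \<noteq> 0\<close> and \<open>z \<noteq> 0\<close>, then the powers of \<open>z\<close> lie in different generalized
  eigenspaces of \<open>ad x\<close>, and so the monomials \<open>y\<^sup>i x\<^sup>j z\<^sup>k\<close> would be independent, against growth.
  Applied over the algebraic closure this gives \<open>D(x) = C(x)\<close>. Hence a solvable \<open>x\<close> lies in
  \<open>\<Delta>\<^sub>1\<close> or in \<open>\<Delta>\<^sub>2\<close> according to whether \<open>N(x) = A\<close> (\<open>solvable_Delta\<close>), and (2) and (3) say the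
  same thing.

  By the universal property of \<open>A\<close>, endomorphisms correspond to pairs with \<open>[x, y] = 1\<close>. An
  automorphism carries \<open>N(p) = A\<close> onto \<open>N(x)\<close>, so (1) implies (2). Conversely let \<open>x\<close>, \<open>y\<close> be the
  images of \<open>p\<close>, \<open>q\<close> under an endomorphism. Both are solvable, as \<open>[- y, x] = 1\<close>, so (2) gives
  \<open>N(x) = N(y) = A\<close>. Decomposing with respect to \<open>ad x\<close> and then, inside \<open>C(x)\<close>, with respect to
  \<open>ad (- y)\<close> shows that \<open>A\<close> is generated by \<open>x\<close>, \<open>y\<close> and \<open>C(x) \<inter> C(y)\<close>. An element \<open>e\<close> of that
  intersection is algebraic over the field, for otherwise the monomials \<open>e\<^sup>k y\<^sup>i x\<^sup>j\<close> would
  contradict growth; and an algebraic element of the domain \<open>A\<close> is a scalar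
  (\<open>canonical_pair_centralizer\<close>). So \<open>x\<close> and \<open>y\<close> generate \<open>A\<close>, which is surjectivity.
  Injectivity is the independence of the monomials \<open>y\<^sup>i x\<^sup>j\<close>.
\<close>

section \<open>Scalars and inner derivations\<close>

lemma free_scalar_central:
  "Poly_Mapping.single 0 c * x = x * Poly_Mapping.single (0 :: gen_word) (c :: 'a::field)"
  by (induction x rule: poly_mapping_single_induct)
     (simp_all add: distrib_left distrib_right mult_single mult.commute)

lemma weyl_scale_mult_left: "weyl_scale c x * y = weyl_scale c (x * y)"
  by transfer (simp add: weyl_eq_def weyl_ideal.zero mult.assoc)

lemma weyl_scale_mult_right: "x * weyl_scale c y = weyl_scale c (x * y)"
  by transfer (simp add: weyl_eq_def weyl_ideal.zero mult.assoc[symmetric] free_scalar_central[symmetric])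

lemmas weyl_scale_mult = weyl_scale_mult_left weyl_scale_mult_right

lemma of_nat_mult_eq_weyl_scale: "of_nat n * (x :: 'a::field weyl) = weyl_scale (of_nat n) x"
  by (induction n) (simp_all add: distrib_right weyl.scale_left_distrib)

lemma of_nat_mult_weyl_eq_0:
  fixes x :: "'a::field_char_0 weyl"
  shows "of_nat n * x = 0 \<longleftrightarrow> n = 0 \<or> x = 0"
  by (simp add: of_nat_mult_eq_weyl_scale)

lemma ad_simps:
  "ad x 0 = 0" "ad x 1 = 0" "ad x x = 0"
  "ad x (a + b) = ad x a + ad x b" "ad x (a - b) = ad x a - ad x b"
  "ad x (a * b) = ad x a * b + a * ad x b"
  for x a b :: "'b::ring_1"
  by (simp_all add: ad_def algebra_simps)

lemma ad_uminus_left: "ad (- x) y = - ad x y"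
  by (simp add: ad_def)

lemma ad_uminus_right: "ad x (- y) = - ad x y"
  by (simp add: ad_def)

lemma ad_swap: "ad x y = - ad y x"
  by (simp add: ad_def)

lemma ad_sum: "ad x (sum f S) = (\<Sum>i\<in>S. ad x (f i))"
  for x :: "'b::ring_1"
  by (induction S rule: infinite_finite_induct) (simp_all add: ad_simps)

lemma ad_of_nat: "ad x (of_nat n) = 0"
  for x :: "'b::ring_1"
  by (induction n) (simp_all add: ad_simps)

lemma ad_of_nat_mult: "ad x (of_nat n * a) = of_nat n * ad x a"
  for x :: "'b::ring_1"
  by (simp add: ad_simps ad_of_nat)

lemma ad_scale: "ad x (weyl_scale c a) = weyl_scale c (ad x a)"
  by (simp add: ad_def weyl_scale_mult weyl.scale_right_diff_distrib)

lemma ad_jacobi: "ad x (ad y a) = ad (ad x y) a + ad y (ad x a)"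
  for x :: "'b::ring_1"
  by (simp add: ad_def algebra_simps)

lemma ad_power_commuting:
  fixes x :: "'b::ring_1"
  assumes "ad x a = 0"
  shows "ad x (a ^ n) = 0"
  by (induction n) (simp_all add: ad_simps assms)

lemma ad_power:
  fixes x :: "'b::ring_1"
  assumes "ad x y = 1"
  shows "ad x (y ^ n) = of_nat n * y ^ (n - 1)"
proof (induction n)
  case (Suc n)
  then show ?case
    by (cases n) (simp_all add: ad_simps assms algebra_simps mult_of_nat_commute)
qed (simp add: ad_simps)

lemma ad_funpow_0 [simp]: "(ad x ^^ n) 0 = 0"
  for x :: "'b::ring_1"
  by (induction n) (simp_all add: ad_simps)

lemma ad_funpow_add: "(ad x ^^ n) (a + b) = (ad x ^^ n) a + (ad x ^^ n) b"
  for x :: "'b::ring_1"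
  by (induction n) (simp_all add: ad_simps)

lemma ad_funpow_diff: "(ad x ^^ n) (a - b) = (ad x ^^ n) a - (ad x ^^ n) b"
  for x :: "'b::ring_1"
  by (induction n) (simp_all add: ad_simps)

lemma ad_funpow_sum: "(ad x ^^ n) (sum f S) = (\<Sum>i\<in>S. (ad x ^^ n) (f i))"
  for x :: "'b::ring_1"
  by (induction S rule: infinite_finite_induct) (simp_all add: ad_funpow_add)

lemma ad_funpow_scale: "(ad x ^^ n) (weyl_scale c a) = weyl_scale c ((ad x ^^ n) a)"
  by (induction n) (simp_all add: ad_scale)

lemma ad_funpow_of_nat_mult: "(ad x ^^ n) (of_nat k * a) = of_nat k * (ad x ^^ n) a"
  for x :: "'b::ring_1"
  by (induction n) (simp_all add: ad_of_nat_mult)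

lemma ad_funpow_eq_0_mono:
  fixes x :: "'b::ring_1"
  assumes "(ad x ^^ m) a = 0" "m \<le> n"
  shows "(ad x ^^ n) a = 0"
proof -
  have "(ad x ^^ (n - m + m)) a = 0" unfolding funpow_add by (simp add: assms(1))
  then show ?thesis using assms(2) by simp
qed

lemma leibniz_formula:
  fixes x :: "'b::ring_1"
  shows "(ad x ^^ n) (a * b) =
    (\<Sum>k\<le>n. of_nat (n choose k) * ((ad x ^^ k) a * (ad x ^^ (n - k)) b))"
proof (induction n arbitrary: a b)
  case (Suc n)
  define f where "f k = (ad x ^^ k) a * (ad x ^^ (Suc n - k)) b" for k
  have 1: "(\<Sum>k\<le>n. of_nat (n choose k) * f k) = f 0 + (\<Sum>k\<le>n. of_nat (n choose Suc k) * f (Suc k))"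
  proof -
    have "(\<Sum>k\<le>n. of_nat (n choose k) * f k) = (\<Sum>k\<le>Suc n. of_nat (n choose k) * f k)"
      by (simp add: binomial_eq_0)
    then show ?thesis by (subst (asm) sum.atMost_Suc_shift) simp
  qed
  have "(ad x ^^ Suc n) (a * b) = (ad x ^^ n) (ad x a * b) + (ad x ^^ n) (a * ad x b)"
    by (simp add: funpow_Suc_right ad_simps ad_funpow_add del: funpow.simps)
  also have "(ad x ^^ n) (ad x a * b) = (\<Sum>k\<le>n. of_nat (n choose k) * f (Suc k))"
    unfolding Suc f_def by (simp add: funpow_Suc_right del: funpow.simps)
  also have "(ad x ^^ n) (a * ad x b) = (\<Sum>k\<le>n. of_nat (n choose k) * f k)"
    unfolding Suc f_def
    by (intro sum.cong refl) (simp add: Suc_diff_le funpow_Suc_right del: funpow.simps)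
  finally have "(ad x ^^ Suc n) (a * b) = f 0 +
      (\<Sum>k\<le>n. of_nat (n choose k) * f (Suc k) + of_nat (n choose Suc k) * f (Suc k))"
    by (simp add: 1 sum.distrib)
  also have "\<dots> = (\<Sum>k\<le>Suc n. of_nat (Suc n choose k) * f k)"
    by (subst sum.atMost_Suc_shift) (simp add: algebra_simps)
  finally show ?case unfolding f_def .
qed simp

text \<open>
  Nilpotency indices add up, with a leading term that is a nonzero multiple of the product of the
  leading terms; this lets an inner derivation play the part of a degree function.
\<close>

lemma leibniz_top:
  fixes x :: "'b::ring_1"
  assumes "(ad x ^^ Suc m) a = 0" "(ad x ^^ Suc n) b = 0"
  shows "(ad x ^^ (m + n)) (a * b) = of_nat (m + n choose m) * ((ad x ^^ m) a * (ad x ^^ n) b)"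
    and "(ad x ^^ Suc (m + n)) (a * b) = 0"
proof -
  have z: "(ad x ^^ k) a * (ad x ^^ l) b = 0" if "k > m \<or> l > n" for k l
    using that ad_funpow_eq_0_mono[OF assms(1), of k] ad_funpow_eq_0_mono[OF assms(2), of l]
    by (auto simp: Suc_le_eq)
  have "(ad x ^^ (m + n)) (a * b) =
      (\<Sum>k\<in>{m}. of_nat (m + n choose k) * ((ad x ^^ k) a * (ad x ^^ (m + n - k)) b))"
    unfolding leibniz_formula
  proof (rule sum.mono_neutral_right)
    show "\<forall>k\<in>{..m + n} - {m}.
        of_nat (m + n choose k) * ((ad x ^^ k) a * (ad x ^^ (m + n - k)) b) = 0"
    proof
      fix k assume "k \<in> {..m + n} - {m}"
      then have "k > m \<or> m + n - k > n" by auto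
      from z[OF this] show "of_nat (m + n choose k) * ((ad x ^^ k) a * (ad x ^^ (m + n - k)) b) = 0"
        by simp
    qed
  qed auto
  then show "(ad x ^^ (m + n)) (a * b) = of_nat (m + n choose m) * ((ad x ^^ m) a * (ad x ^^ n) b)"
    by simp
  show "(ad x ^^ Suc (m + n)) (a * b) = 0"
    unfolding leibniz_formula by (intro sum.neutral ballI) (subst z; auto)
qed

lemma weyl_N_iff: "a \<in> weyl_N x \<longleftrightarrow> (\<exists>n. (ad x ^^ n) a = 0)"
proof
  assume "\<exists>n. (ad x ^^ n) a = 0"
  then obtain n where "(ad x ^^ n) a = 0" by blast
  then have "(ad x ^^ Suc n) a = 0" by (simp add: ad_simps)
  then show "a \<in> weyl_N x" unfolding weyl_N_def by blast
qed (auto simp: weyl_N_def)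

lemma weyl_N_add: "a \<in> weyl_N x \<Longrightarrow> b \<in> weyl_N x \<Longrightarrow> a + b \<in> weyl_N x"
proof -
  assume "a \<in> weyl_N x" "b \<in> weyl_N x"
  then obtain m n where "(ad x ^^ m) a = 0" "(ad x ^^ n) b = 0" by (auto simp: weyl_N_iff)
  then have "(ad x ^^ (m + n)) (a + b) = 0"
    using ad_funpow_eq_0_mono[of m x a "m + n"] ad_funpow_eq_0_mono[of n x b "m + n"]
    by (simp add: ad_funpow_add)
  then show ?thesis by (auto simp: weyl_N_iff)
qed

lemma weyl_N_scale: "a \<in> weyl_N x \<Longrightarrow> weyl_scale c a \<in> weyl_N x"
  by (auto simp: weyl_N_iff ad_funpow_scale)

lemma weyl_N_ad: "a \<in> weyl_N x \<Longrightarrow> ad x a \<in> weyl_N x"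
  by (metis ad_funpow_0 ad_simps(1) funpow_swap1 weyl_N_iff)

lemma weyl_N_mult: "a \<in> weyl_N x \<Longrightarrow> b \<in> weyl_N x \<Longrightarrow> a * b \<in> weyl_N x"
proof -
  assume "a \<in> weyl_N x" "b \<in> weyl_N x"
  then obtain m n where "(ad x ^^ m) a = 0" "(ad x ^^ n) b = 0" by (auto simp: weyl_N_iff)
  then have "(ad x ^^ Suc m) a = 0" "(ad x ^^ Suc n) b = 0" by (simp_all add: ad_simps)
  from leibniz_top(2)[OF this] show ?thesis unfolding weyl_N_iff by blast
qed

lemma weyl_N_subspace: "weyl.subspace (weyl_N x)"
proof -
  have "(0 :: 'a weyl) \<in> weyl_N x" using weyl_N_iff[of 0 x] by simp
  then show ?thesis by (intro weyl.subspaceI) (auto simp: weyl_N_add weyl_N_scale)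
qed

lemma weyl_N_sum: "(\<And>i. i \<in> S \<Longrightarrow> f i \<in> weyl_N x) \<Longrightarrow> sum f S \<in> weyl_N x"
  by (rule weyl.subspace_sum[OF weyl_N_subspace])

lemma weyl_N_commuting: "ad x a = 0 \<Longrightarrow> a \<in> weyl_N x"
  unfolding weyl_N_iff by (rule exI[of _ 1]) simp

lemma weyl_N_power: "a \<in> weyl_N x \<Longrightarrow> a ^ n \<in> weyl_N x"
  by (induction n) (auto intro: weyl_N_mult weyl_N_commuting simp: ad_simps)

lemma weyl_N_slice: "ad x y = 1 \<Longrightarrow> y \<in> weyl_N x"
  unfolding weyl_N_iff by (rule exI[of _ 2]) (simp add: numeral_2_eq_2 ad_simps)

text \<open>
  Together with the fact that \<open>(x, y)\<close> may be replaced by \<open>(- y, x)\<close>, this lets every statement about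
  the first member of a pair with \<open>[x, y] = 1\<close> be applied to the second.
\<close>

lemma weyl_N_uminus: "weyl_N (- x) = weyl_N x"
proof -
  have "(ad (- x) ^^ n) a = 0 \<longleftrightarrow> (ad x ^^ n) a = 0" for n a
  proof -
    have "(ad (- x) ^^ n) a = (ad x ^^ n) a \<or> (ad (- x) ^^ n) a = - (ad x ^^ n) a"
    proof (induction n)
      case (Suc n)
      then show ?case by (auto simp: ad_uminus_left ad_uminus_right)
    qed simp
    then show ?thesis by auto
  qed
  then show ?thesis by (auto simp: weyl_N_iff)
qed

lemma locally_nilpotent_eigenvector:
  assumes "a \<in> weyl_N x" "ad x a = weyl_scale l a" "l \<noteq> 0"
  shows "a = 0"
proof -
  have "(ad x ^^ n) a = weyl_scale (l ^ n) a" for n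
    by (induction n) (simp_all add: ad_scale assms(2) mult.commute)
  then show ?thesis using assms(1,3) by (auto simp: weyl_N_iff)
qed

section \<open>Normal form and growth\<close>

lemma weyl_generated:
  fixes S :: "'a::field weyl set"
  assumes sub: "weyl.subspace S" and one: "1 \<in> S" and "weyl_p \<in> S" "weyl_q \<in> S"
    and mult: "\<And>x y. x \<in> S \<Longrightarrow> y \<in> S \<Longrightarrow> x * y \<in> S"
  shows "x \<in> S"
proof -
  have word: "abs_weyl (Poly_Mapping.single (GWord l) 1) \<in> S" for l
  proof (induction l)
    case Nil
    then show ?case using one by (simp add: one_weyl_def zero_gen_word_def flip: single_one)
  next
    case (Cons g l)
    have "abs_weyl (Poly_Mapping.single (GWord (g # l)) (1 :: 'a)) =
        abs_weyl (free_gen g * Poly_Mapping.single (GWord l) 1)"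
      by (simp add: free_gen_def mult_single plus_gen_word_def)
    also have "\<dots> = abs_weyl (free_gen g) * abs_weyl (Poly_Mapping.single (GWord l) 1)"
      by (simp add: times_weyl.abs_eq)
    finally show ?case
      using assms(3,4) Cons by (cases g) (auto intro: mult simp: weyl_p_def weyl_q_def)
  qed
  have "abs_weyl u \<in> S" for u
  proof (induction u rule: poly_mapping_single_induct)
    case zero
    then show ?case using weyl.subspace_0[OF sub] by (simp add: zero_weyl_def)
  next
    case (single_add w c u)
    have "abs_weyl (Poly_Mapping.single w c) = weyl_scale c (abs_weyl (Poly_Mapping.single w 1))"
      by (simp add: weyl_scale.abs_eq mult_single)
    then have "abs_weyl (Poly_Mapping.single w c) \<in> S"
      using word[of "letters w"] weyl.subspace_scale[OF sub] by simp
    then show ?case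
      using single_add weyl.subspace_add[OF sub] by (simp flip: plus_weyl.abs_eq)
  qed
  then show ?thesis by (metis Quotient_weyl Quotient_abs_rep)
qed

text \<open>
  The Poincare--Birkhoff--Witt monomials.
\<close>

definition pbw :: "nat \<times> nat \<Rightarrow> 'a::field weyl" where
  "pbw = (\<lambda>(i, j). weyl_q ^ i * weyl_p ^ j)"

text \<open>
  Bounding both exponents separately gives a filtration of \<open>A\<close>, because rewriting \<open>p q\<close> as \<open>q p + 1\<close>
  never raises an exponent.
\<close>

definition weyl_box :: "nat \<Rightarrow> nat \<Rightarrow> 'a::field weyl set" where
  "weyl_box m n = weyl.span (pbw ` ({..m} \<times> {..n}))"

lemma weyl_box_mono: "i \<le> m \<Longrightarrow> j \<le> n \<Longrightarrow> weyl_box i j \<subseteq> weyl_box m n"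
  unfolding weyl_box_def by (intro weyl.span_mono image_mono) auto

lemma weyl_box_subspace: "weyl.subspace (weyl_box m n)"
  by (simp add: weyl_box_def)

lemma monomial_in_weyl_box: "i \<le> m \<Longrightarrow> j \<le> n \<Longrightarrow> weyl_q ^ i * weyl_p ^ j \<in> weyl_box m n"
  unfolding weyl_box_def by (intro weyl.span_base image_eqI[of _ _ "(i, j)"]) (auto simp: pbw_def)

lemma weyl_box_subset:
  assumes "weyl.subspace S" "\<And>i j. i \<le> m \<Longrightarrow> j \<le> n \<Longrightarrow> weyl_q ^ i * weyl_p ^ j \<in> S"
  shows "weyl_box m n \<subseteq> S"
  unfolding weyl_box_def by (rule weyl.span_minimal) (use assms in \<open>auto simp: pbw_def\<close>)

lemma subspace_mult_left: "weyl.subspace S \<Longrightarrow> weyl.subspace {a. b * a \<in> S}"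
  by (intro weyl.subspaceI)
     (auto simp: distrib_left weyl_scale_mult weyl.subspace_add weyl.subspace_scale weyl.subspace_0)

lemma subspace_mult_right: "weyl.subspace S \<Longrightarrow> weyl.subspace {a. a * b \<in> S}"
  by (intro weyl.subspaceI)
     (auto simp: distrib_right weyl_scale_mult weyl.subspace_add weyl.subspace_scale weyl.subspace_0)

lemma p_power_q_power_in_weyl_box: "weyl_p ^ j * weyl_q ^ k \<in> weyl_box k j"
proof (induction j)
  case 0
  then show ?case using monomial_in_weyl_box[of k k 0 0] by simp
next
  case (Suc j)
  have "weyl_box k j \<subseteq> {a :: 'a weyl. weyl_p * a \<in> weyl_box k (Suc j)}"
  proof (rule weyl_box_subset)
    show "weyl.subspace {a :: 'a weyl. weyl_p * a \<in> weyl_box k (Suc j)}"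
      by (intro subspace_mult_left weyl_box_subspace)
  next
    fix i l assume il: "i \<le> k" "l \<le> j"
    have "weyl_p * weyl_q ^ i = weyl_q ^ i * weyl_p + weyl_scale (of_nat i) (weyl_q ^ (i - 1) :: 'a weyl)"
      using ad_power[OF ad_weyl_p_q, of i]
      by (simp add: ad_def algebra_simps of_nat_mult_eq_weyl_scale)
    then have "weyl_p * (weyl_q ^ i * weyl_p ^ l) = weyl_q ^ i * weyl_p ^ Suc l +
        weyl_scale (of_nat i) (weyl_q ^ (i - 1) * weyl_p ^ l :: 'a weyl)"
      by (simp add: distrib_right weyl_scale_mult mult.assoc flip: mult.assoc[of weyl_p])
    moreover have "weyl_q ^ i * weyl_p ^ Suc l \<in> weyl_box k (Suc j)"
      "weyl_q ^ (i - 1) * weyl_p ^ l \<in> weyl_box k (Suc j)"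
      by (rule monomial_in_weyl_box; use il in simp)+
    ultimately show "weyl_q ^ i * weyl_p ^ l \<in> {a :: 'a weyl. weyl_p * a \<in> weyl_box k (Suc j)}"
      using weyl.subspace_add[OF weyl_box_subspace] weyl.subspace_scale[OF weyl_box_subspace]
      by (metis mem_Collect_eq)
  qed
  then show ?case using Suc by (auto simp: mult.assoc)
qed

lemma weyl_box_mult:
  assumes "a \<in> weyl_box m m" "b \<in> weyl_box n n"
  shows "a * b \<in> weyl_box (m + n) (m + n)"
proof -
  let ?B = "weyl_box (m + n) (m + n)"
  have mono: "weyl_q ^ i * weyl_p ^ j * (weyl_q ^ k * weyl_p ^ l) \<in> ?B"
    if le: "i \<le> m" "j \<le> m" "k \<le> n" "l \<le> n" for i j k l
  proof -
    have "weyl_box k j \<subseteq> {c. weyl_q ^ i * c \<in> {a. a * weyl_p ^ l \<in> ?B}}"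
    proof (rule weyl_box_subset)
      show "weyl.subspace {c. weyl_q ^ i * c \<in> {a. a * weyl_p ^ l \<in> ?B}}"
        by (intro subspace_mult_left subspace_mult_right weyl_box_subspace)
    next
      fix r s assume "r \<le> k" "s \<le> j"
      then have "weyl_q ^ (i + r) * weyl_p ^ (s + l) \<in> ?B"
        by (intro monomial_in_weyl_box) (use le in auto)
      then show "weyl_q ^ r * weyl_p ^ s \<in> {c. weyl_q ^ i * c \<in> {a. a * weyl_p ^ l \<in> ?B}}"
        by (simp add: power_add mult.assoc)
    qed
    then have "weyl_q ^ i * (weyl_p ^ j * weyl_q ^ k) * weyl_p ^ l \<in> ?B"
      using p_power_q_power_in_weyl_box by blast
    then show ?thesis by (simp add: mult.assoc)
  qed
  have "weyl_box n n \<subseteq> {b. weyl_q ^ i * weyl_p ^ j * b \<in> ?B}" if "i \<le> m" "j \<le> m" for i j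
    by (rule weyl_box_subset) (use that mono subspace_mult_left[OF weyl_box_subspace] in auto)
  then have "weyl_box m m \<subseteq> {a. a * b \<in> ?B}"
    using assms(2)
    by (intro weyl_box_subset subspace_mult_right weyl_box_subspace) auto
  then show ?thesis using assms(1) by blast
qed

lemma weyl_box_exhausts: "\<exists>n. a \<in> weyl_box n n"
proof -
  let ?S = "\<Union>n. weyl_box n n :: 'a weyl set"
  have "a \<in> ?S"
  proof (rule weyl_generated)
    have add: "x + y \<in> ?S" if xy: "x \<in> ?S" "y \<in> ?S" for x y
    proof -
      from xy obtain m n where mn: "x \<in> weyl_box m m" "y \<in> weyl_box n n" by auto
      then have "x \<in> weyl_box (m + n) (m + n)" "y \<in> weyl_box (m + n) (m + n)"
        using weyl_box_mono[of m "m + n" m "m + n"] weyl_box_mono[of n "m + n" n "m + n"] by auto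
      then show ?thesis using weyl.subspace_add[OF weyl_box_subspace] by blast
    qed
    show "weyl.subspace ?S"
      by (intro weyl.subspaceI add)
         (auto intro: weyl.subspace_0[OF weyl_box_subspace] weyl.subspace_scale[OF weyl_box_subspace])
    show "1 \<in> ?S" using monomial_in_weyl_box[of 0 0 0 0] by auto
    show "weyl_p \<in> ?S" using monomial_in_weyl_box[of 0 1 1 1] by auto
    show "weyl_q \<in> ?S" using monomial_in_weyl_box[of 1 1 0 1] by auto
    show "x * y \<in> ?S" if "x \<in> ?S" "y \<in> ?S" for x y using that weyl_box_mult by blast
  qed
  then show ?thesis by auto
qed

lemma in_span_image:
  assumes "finite I" "a \<in> weyl.span (f ` I)"
  shows "\<exists>c. a = (\<Sum>i\<in>I. weyl_scale (c i) (f i))"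
proof -
  let ?T = "{a. \<exists>c. a = (\<Sum>i\<in>I. weyl_scale (c i) (f i))}"
  have "weyl.span (f ` I) \<subseteq> ?T"
  proof (rule weyl.span_minimal)
    show "f ` I \<subseteq> ?T"
    proof clarify
      fix i assume "i \<in> I"
      then have "f i = (\<Sum>j\<in>I. weyl_scale (if j = i then 1 else 0) (f j))"
        using assms(1) by (simp add: if_distrib[of "\<lambda>c. weyl_scale c _"] sum.delta' cong: if_cong)
      then show "\<exists>c. f i = (\<Sum>j\<in>I. weyl_scale (c j) (f j))" by (intro exI)
    qed
    show "weyl.subspace ?T"
    proof (intro weyl.subspaceI; clarify)
      show "\<exists>c. 0 = (\<Sum>i\<in>I. weyl_scale (c i) (f i))" by (rule exI[of _ "\<lambda>_. 0"]) simp
      fix c d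
      show "\<exists>e. (\<Sum>i\<in>I. weyl_scale (c i) (f i)) + (\<Sum>i\<in>I. weyl_scale (d i) (f i)) =
          (\<Sum>i\<in>I. weyl_scale (e i) (f i))"
        by (rule exI[of _ "\<lambda>i. c i + d i"]) (simp add: weyl.scale_left_distrib sum.distrib)
    next
      fix r c
      show "\<exists>e. weyl_scale r (\<Sum>i\<in>I. weyl_scale (c i) (f i)) = (\<Sum>i\<in>I. weyl_scale (e i) (f i))"
        by (rule exI[of _ "\<lambda>i. r * c i"]) (simp add: weyl.scale_sum_right)
    qed
  qed
  then show ?thesis using assms(2) by auto
qed

lemma weyl_normal_form:
  "\<exists>n c. a = (\<Sum>j<n. (\<Sum>i<n. weyl_scale (c i j) (weyl_q ^ i)) * weyl_p ^ j)"
proof -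
  obtain n where "a \<in> weyl_box n n" using weyl_box_exhausts by blast
  then obtain c where "a = (\<Sum>ij\<in>{..n} \<times> {..n}. weyl_scale (c ij) (pbw ij))"
    unfolding weyl_box_def using in_span_image[of "{..n} \<times> {..n}" a pbw] by auto
  also have "\<dots> = (\<Sum>i<Suc n. \<Sum>j<Suc n. weyl_scale (c (i, j)) (weyl_q ^ i * weyl_p ^ j))"
    by (simp add: sum.cartesian_product pbw_def lessThan_Suc_atMost split_def)
  also have "\<dots> = (\<Sum>j<Suc n. (\<Sum>i<Suc n. weyl_scale (c (i, j)) (weyl_q ^ i)) * weyl_p ^ j)"
    by (subst sum.swap) (simp only: sum_distrib_right weyl_scale_mult)
  finally show ?thesis by (intro exI[of _ "Suc n"] exI[of _ "\<lambda>i j. c (i, j)"])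
qed

text \<open>
  Stated for families instead of sets, so that coinciding members already count as a dependence.
\<close>

lemma dependent_family:
  fixes f :: "'i \<Rightarrow> 'a::field weyl"
  assumes "finite T" "finite I" "card T < card I" "f ` I \<subseteq> weyl.span T"
  shows "\<exists>c. (\<exists>i\<in>I. c i \<noteq> 0) \<and> (\<Sum>i\<in>I. weyl_scale (c i) (f i)) = 0"
proof (cases "inj_on f I")
  case True
  then have "card (f ` I) > card T" using assms(3) by (simp add: card_image)
  then have "weyl.dependent (f ` I)"
    using weyl.independent_span_bound[OF assms(1) _ assms(4)] by force
  then obtain u where u: "\<exists>v\<in>f ` I. u v \<noteq> 0" "(\<Sum>v\<in>f ` I. weyl_scale (u v) v) = 0"
    using weyl.dependent_finite[of "f ` I"] assms(2) by auto
  have "(\<Sum>i\<in>I. weyl_scale (u (f i)) (f i)) = 0"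
    using u(2) by (simp add: sum.reindex[OF True])
  then show ?thesis using u(1) by (intro exI[of _ "\<lambda>i. u (f i)"]) auto
next
  case False
  then obtain i j where ij: "i \<in> I" "j \<in> I" "i \<noteq> j" "f i = f j" by (auto simp: inj_on_def)
  let ?c = "\<lambda>k. if k = i then 1 :: 'a else if k = j then - 1 else 0"
  have "(\<Sum>k\<in>I. weyl_scale (?c k) (f k)) = (\<Sum>k\<in>{i, j}. weyl_scale (?c k) (f k))"
    by (rule sum.mono_neutral_right) (use ij assms(2) in auto)
  also have "\<dots> = 0" using ij by auto
  finally have "(\<Sum>k\<in>I. weyl_scale (?c k) (f k)) = 0" .
  moreover have "\<exists>k\<in>I. ?c k \<noteq> 0" using ij(1) by (intro bexI[of _ i]) auto
  ultimately show ?thesis by (intro exI[of _ ?c]) (rule conjI)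
qed

lemma weyl_box_power: "a \<in> weyl_box d d \<Longrightarrow> a ^ k \<in> weyl_box (k * d) (k * d)"
proof (induction k)
  case 0
  then show ?case using monomial_in_weyl_box[of 0 0 0 0] by simp
next
  case (Suc k)
  then show ?case using weyl_box_mult[of a d "a ^ k" "k * d"] by simp
qed

text \<open>
  If \<open>x\<close>, \<open>y\<close>, \<open>z\<close> lie in the box of side \<open>d\<close>, the \<open>n\<^sup>3\<close> monomials with exponents below \<open>n\<close> lie in
  the box of side \<open>3 n d\<close>, whose dimension is only quadratic in \<open>n\<close>. The dependence is written as
  a polynomial in \<open>z\<close> whose coefficients are polynomials in \<open>y\<close>, the form in which leading
  coefficients can be compared.
\<close>

lemma growth_dependence:
  fixes x y z :: "'a::field weyl"
  obtains n c where "\<exists>i<n. \<exists>j<n. \<exists>k<n. c i j k \<noteq> 0"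
    and "(\<Sum>k<n. (\<Sum>j<n. (\<Sum>i<n. weyl_scale (c i j k) (x ^ i)) * y ^ j) * z ^ k) = 0"
proof -
  obtain d1 d2 d3 where "x \<in> weyl_box d1 d1" "y \<in> weyl_box d2 d2" "z \<in> weyl_box d3 d3"
    using weyl_box_exhausts by meson
  moreover define d where "d = Suc (d1 + d2 + d3)"
  ultimately have d: "x \<in> weyl_box d d" "y \<in> weyl_box d d" "z \<in> weyl_box d d"
    using weyl_box_mono[of d1 d d1 d] weyl_box_mono[of d2 d d2 d] weyl_box_mono[of d3 d d3 d]
    by auto
  \<comment> \<open>Since \<open>d > 0\<close>, \<open>(3 n d + 1)\<^sup>2 \<le> 16 n\<^sup>2 d\<^sup>2\<close>, which is below \<open>n\<^sup>3\<close> once \<open>n > 16 d\<^sup>2\<close>.\<close>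
  define n where "n = Suc (16 * d * d)"
  define N where "N = n * d + n * d + n * d"
  let ?f = "\<lambda>(i, j, k). x ^ i * y ^ j * z ^ k"
  let ?I = "{..<n} \<times> {..<n} \<times> {..<n}"
  let ?T = "pbw ` ({..N} \<times> {..N}) :: 'a weyl set"
  have pow: "a ^ i \<in> weyl_box (n * d) (n * d)" if "a \<in> weyl_box d d" "i < n" for a :: "'a weyl" and i
    using weyl_box_power[OF that(1), of i] weyl_box_mono[of "i * d" "n * d" "i * d" "n * d"] that(2)
    by auto
  have sub: "?f ` ?I \<subseteq> weyl.span ?T"
  proof clarify
    fix i j k assume "i < n" "j < n" "k < n"
    then have "x ^ i * y ^ j * z ^ k \<in> weyl_box (n * d + n * d + n * d) (n * d + n * d + n * d)"
      by (intro weyl_box_mult pow d)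
    then show "x ^ i * y ^ j * z ^ k \<in> weyl.span ?T" by (simp add: weyl_box_def N_def)
  qed
  have "card ?T \<le> (N + 1) * (N + 1)"
    using card_image_le[of "{..N} \<times> {..N}" "pbw :: _ \<Rightarrow> 'a weyl"] by simp
  also have "\<dots> \<le> (4 * (n * d)) * (4 * (n * d))"
    by (intro mult_mono) (auto simp: N_def n_def d_def)
  also have "\<dots> = n * n * (16 * d * d)" by simp
  also have "\<dots> < n * n * n" by (simp add: n_def)
  finally have "card ?T < card ?I" by simp
  from dependent_family[OF _ _ this sub] obtain c where
    c: "\<exists>t\<in>?I. c t \<noteq> 0" "(\<Sum>t\<in>?I. weyl_scale (c t) (?f t)) = 0" by auto
  let ?g = "\<lambda>i j k. weyl_scale (c (i, j, k)) (x ^ i * y ^ j * z ^ k)"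
  have "(\<Sum>i<n. \<Sum>j<n. \<Sum>k<n. ?g i j k) = 0"
    using c(2) by (simp add: sum.cartesian_product split_def)
  also have "(\<Sum>i<n. \<Sum>j<n. \<Sum>k<n. ?g i j k) = (\<Sum>i<n. \<Sum>k<n. \<Sum>j<n. ?g i j k)"
    by (rule sum.cong[OF refl sum.swap])
  also have "\<dots> = (\<Sum>k<n. \<Sum>i<n. \<Sum>j<n. ?g i j k)" by (rule sum.swap)
  also have "\<dots> = (\<Sum>k<n. \<Sum>j<n. \<Sum>i<n. ?g i j k)"
    by (rule sum.cong[OF refl sum.swap])
  finally have "(\<Sum>k<n. (\<Sum>j<n. (\<Sum>i<n. weyl_scale (c (i, j, k)) (x ^ i)) * y ^ j) * z ^ k) = 0"
    by (simp add: sum_distrib_right weyl_scale_mult)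
  moreover have "\<exists>i<n. \<exists>j<n. \<exists>k<n. c (i, j, k) \<noteq> 0" using c(1) by auto
  ultimately show ?thesis by (intro that[of n "\<lambda>i j k. c (i, j, k)"])
qed

section \<open>Independence relative to a canonical pair\<close>

text \<open>
  Differentiating a relation \<open>\<Sum>\<^sub>j c\<^sub>j y\<^sup>j = 0\<close> by \<open>ad x\<close> gives a shorter one with the coefficients
  \<open>(j + 1) c\<^sub>j\<^sub>+\<^sub>1\<close>; characteristic zero then kills all coefficients but the constant one.
\<close>

lemma slice_independence:
  fixes x y :: "'a::field_char_0 weyl"
  assumes xy: "ad x y = 1"
    and "\<And>j. ad x (c j) = 0" "(\<Sum>j<n. c j * y ^ j) = 0" "j < n"
  shows "c j = 0"
  using assms(2-)
proof (induction n arbitrary: c j)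
  case (Suc n)
  have "0 = ad x (\<Sum>j<Suc n. c j * y ^ j)" by (simp only: Suc.prems ad_simps)
  also have "\<dots> = (\<Sum>j<Suc n. of_nat j * (c j * y ^ (j - 1)))"
    by (simp only: ad_sum ad_simps Suc.prems(1) ad_power[OF xy])
       (simp add: of_nat_mult_eq_weyl_scale weyl_scale_mult)
  also have "\<dots> = (\<Sum>j<n. (of_nat (Suc j) * c (Suc j)) * y ^ j)"
    by (subst sum.lessThan_Suc_shift) (simp add: mult.assoc)
  finally have "of_nat (Suc k) * c (Suc k) = 0" if "k < n" for k
    using Suc.IH[of "\<lambda>j. of_nat (Suc j) * c (Suc j)" k] that Suc.prems(1)
    by (simp add: ad_of_nat_mult del: of_nat_Suc)
  then have pos: "c (Suc k) = 0" if "k < n" for k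
    using that by (simp add: of_nat_mult_weyl_eq_0 del: of_nat_Suc)
  have "c 0 = (\<Sum>j<Suc n. c j * y ^ j)"
    by (subst sum.lessThan_Suc_shift) (simp add: pos)
  then have "c 0 = 0" using Suc.prems(2) by simp
  then show ?case using pos Suc.prems(3) by (cases j) auto
qed simp

lemma ad_swapped_slice: "ad x y = 1 \<Longrightarrow> ad (- y) x = 1"
  by (simp add: ad_def)

text \<open>
  Slice independence for \<open>(- y, x)\<close> separates the powers of \<open>x\<close>, and then for \<open>(x, y)\<close> those of \<open>y\<close>.
\<close>

lemma canonical_pair_independence:
  fixes x y :: "'a::field_char_0 weyl"
  assumes xy: "ad x y = 1"
    and c: "\<And>i j. ad x (c i j) = 0" "\<And>i j. ad y (c i j) = 0"
    and sum0: "(\<Sum>j<n. (\<Sum>i<n. c i j * y ^ i) * x ^ j) = 0" and "i < n" "j < n"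
  shows "c i j = 0"
proof -
  have "ad y (\<Sum>i<n. c i j * y ^ i) = 0" for j
    by (simp add: ad_sum ad_simps c ad_power_commuting)
  then have "(\<Sum>i<n. c i j * y ^ i) = 0"
    using slice_independence[OF ad_swapped_slice[OF xy] _ sum0 \<open>j < n\<close>] by (simp add: ad_uminus_left)
  then show ?thesis using slice_independence[OF xy _ _ \<open>i < n\<close>, of "\<lambda>i. c i j"] c by blast
qed

lemma slice_constant_term:
  fixes x y :: "'a::field_char_0 weyl"
  assumes xy: "ad x y = 1" and c: "\<And>j. ad x (c j) = 0" and e: "ad x e = 0"
    and "e = (\<Sum>j<n. c j * y ^ j)"
  shows "e = 0 \<or> e = c 0"
proof (cases n)
  case (Suc m)
  let ?c = "\<lambda>j. c j - (if j = 0 then e else 0)"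
  have "(\<Sum>j<n. ?c j * y ^ j) = (\<Sum>j<n. c j * y ^ j) - (\<Sum>j<n. (if j = 0 then e else 0) * y ^ j)"
    by (simp add: left_diff_distrib sum_subtractf)
  also have "(\<Sum>j<n. (if j = 0 then e else 0) * y ^ j) = e"
    unfolding Suc by (subst sum.lessThan_Suc_shift) simp
  finally have "(\<Sum>j<n. ?c j * y ^ j) = 0" using assms(4) by simp
  from slice_independence[OF xy _ this, of 0] show ?thesis by (simp add: Suc c e ad_simps)
qed (simp add: assms(4))

text \<open>
  In the normal form of \<open>e\<close>, commuting with \<open>q\<close> leaves no power of \<open>p\<close>, and commuting with \<open>p\<close> no
  power of \<open>q\<close>.
\<close>

lemma weyl_center:
  fixes e :: "'a::field_char_0 weyl"
  assumes "ad weyl_p e = 0" "ad weyl_q e = 0"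
  shows "e \<in> weyl_scalars"
proof -
  obtain n c where e: "e = (\<Sum>j<n. (\<Sum>i<n. weyl_scale (c i j) (weyl_q ^ i)) * weyl_p ^ j)"
    using weyl_normal_form by blast
  have "e = 0 \<or> e = (\<Sum>i<n. weyl_scale (c i 0) (weyl_q ^ i))"
    by (rule slice_constant_term[OF ad_swapped_slice[OF ad_weyl_p_q] _ _ e])
       (simp_all add: ad_uminus_left assms ad_sum ad_scale ad_power_commuting ad_simps)
  then have "e = 0 \<or> e = (\<Sum>i<n. weyl_scale (c i 0) 1 * weyl_q ^ i)"
    by (simp add: weyl_scale_mult)
  then have "e = 0 \<or> e = weyl_scale (c 0 0) 1"
    using slice_constant_term[OF ad_weyl_p_q, of "\<lambda>i. weyl_scale (c i 0) 1" e n] assms(1)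
    by (auto simp: ad_scale ad_simps)
  then show ?thesis unfolding weyl_scalars_def by (metis rangeI weyl.scale_zero_left)
qed

section \<open>The Weyl algebra is a domain\<close>

lemma weyl_N_eq_UNIV:
  fixes u :: "'a::field weyl"
  assumes "weyl_p \<in> weyl_N u" "weyl_q \<in> weyl_N u"
  shows "weyl_N u = UNIV"
proof -
  have "a \<in> weyl_N u" for a
    by (rule weyl_generated[OF weyl_N_subspace _ assms])
       (auto intro: weyl_N_mult weyl_N_commuting simp: ad_simps)
  then show ?thesis by blast
qed

lemma weyl_N_p: "weyl_N weyl_p = UNIV"
  by (intro weyl_N_eq_UNIV weyl_N_slice ad_weyl_p_q weyl_N_commuting ad_simps)

lemma weyl_N_q: "weyl_N weyl_q = UNIV"
  using weyl_N_slice[OF ad_swapped_slice[OF ad_weyl_p_q]]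
  by (intro weyl_N_eq_UNIV) (auto simp: weyl_N_uminus ad_simps intro: weyl_N_commuting)

lemma nilpotency_index:
  assumes "a \<in> weyl_N x" "a \<noteq> 0"
  obtains m where "(ad x ^^ m) a \<noteq> 0" "(ad x ^^ Suc m) a = 0"
proof -
  obtain n where "(ad x ^^ n) a = 0" using assms(1) by (auto simp: weyl_N_iff)
  then obtain k where k: "\<forall>i<k. (ad x ^^ i) a \<noteq> 0" "(ad x ^^ k) a = 0"
    using ex_least_nat_le[of "\<lambda>n. (ad x ^^ n) a = 0" n] by blast
  show ?thesis
  proof (cases k)
    case 0
    then show ?thesis using k(2) assms(2) by simp
  next
    case (Suc m)
    then show ?thesis using k that[of m] by blast
  qed
qed

lemma ad_funpow_centralizer:
  fixes u v b :: "'b::ring_1"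
  assumes "ad u v = 1 \<or> ad u v = - 1" "ad u b = 0"
  shows "ad u ((ad v ^^ n) b) = 0"
proof (induction n)
  case (Suc n)
  have "ad (ad u v) c = 0" for c using assms(1) by (auto simp: ad_def)
  then show ?case using Suc by (simp add: ad_jacobi[of u v] ad_simps)
qed (simp add: assms(2))

text \<open>
  Replacing two nonzero factors by their leading terms with respect to \<open>ad q\<close>, and these by their
  leading terms with respect to \<open>ad p\<close>, keeps the factors nonzero and the product zero, and ends with
  two central elements, that is, with two scalars.
\<close>

lemma weyl_no_zero_divisors:
  fixes a b :: "'a::field_char_0 weyl"
  assumes "a \<noteq> 0" "b \<noteq> 0"
  shows "a * b \<noteq> 0"
proof
  assume "a * b = 0"
  \<comment> \<open>One such replacement, for a derivation \<open>ad u\<close> that is locally nilpotent on all of \<open>A\<close>.\<close>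
  have reduce: "\<exists>k l. (ad u ^^ k) a \<noteq> 0 \<and> ad u ((ad u ^^ k) a) = 0 \<and>
      (ad u ^^ l) b \<noteq> 0 \<and> ad u ((ad u ^^ l) b) = 0 \<and> (ad u ^^ k) a * (ad u ^^ l) b = 0"
    if N: "weyl_N u = UNIV" and ab: "a \<noteq> 0" "b \<noteq> 0" "a * b = 0" for u a b :: "'a weyl"
  proof -
    obtain k l where k: "(ad u ^^ k) a \<noteq> 0" "(ad u ^^ Suc k) a = 0"
      and l: "(ad u ^^ l) b \<noteq> 0" "(ad u ^^ Suc l) b = 0"
      using nilpotency_index[of a u] nilpotency_index[of b u] ab(1,2) N by (metis UNIV_I)
    have "of_nat (k + l choose k) * ((ad u ^^ k) a * (ad u ^^ l) b) = 0"
      using leibniz_top(1)[OF k(2) l(2)] ab(3) by simp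
    then show ?thesis
      using k l by (intro exI[of _ k] exI[of _ l]) (simp add: of_nat_mult_weyl_eq_0)
  qed
  obtain a1 b1 :: "'a weyl" where 1: "a1 \<noteq> 0" "b1 \<noteq> 0" "ad weyl_q a1 = 0" "ad weyl_q b1 = 0" "a1 * b1 = 0"
    using reduce[OF weyl_N_q assms \<open>a * b = 0\<close>] by blast
  have qp: "ad weyl_q weyl_p = (- 1 :: 'a weyl)" by (simp only: ad_swap[of weyl_q weyl_p] ad_weyl_p_q)
  obtain a2 b2 :: "'a weyl" where "a2 \<noteq> 0" "b2 \<noteq> 0" "ad weyl_p a2 = 0" "ad weyl_p b2 = 0"
    "ad weyl_q a2 = 0" "ad weyl_q b2 = 0" "a2 * b2 = 0"
    using reduce[OF weyl_N_p 1(1,2,5)] ad_funpow_centralizer[of weyl_q weyl_p] qp 1(3,4) by metis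
  then obtain r s :: 'a where "a2 = weyl_scale r 1" "b2 = weyl_scale s 1"
    using weyl_center[of a2] weyl_center[of b2] by (auto simp: weyl_scalars_def)
  then show False
    using \<open>a2 \<noteq> 0\<close> \<open>b2 \<noteq> 0\<close> \<open>a2 * b2 = 0\<close> by (simp add: weyl_scale_mult)
qed

instance weyl :: (field_char_0) ring_1_no_zero_divisors
  by standard (rule weyl_no_zero_divisors)

lemma nilpotency_index_power:
  fixes e :: "'a::field_char_0 weyl"
  assumes "(ad u ^^ m) e \<noteq> 0" "(ad u ^^ Suc m) e = 0"
  shows "(ad u ^^ (k * m)) (e ^ k) \<noteq> 0 \<and> (ad u ^^ Suc (k * m)) (e ^ k) = 0"
proof (induction k)
  case (Suc k)
  have "of_nat (m + k * m choose m) * ((ad u ^^ m) e * (ad u ^^ (k * m)) (e ^ k)) \<noteq> 0"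
    by (subst of_nat_mult_weyl_eq_0) (use Suc assms(1) in simp)
  with Suc show ?case
    using leibniz_top[OF assms(2), of "k * m" "e ^ k"] by (simp del: funpow.simps)
qed (simp add: ad_simps)

text \<open>
  In a domain a locally nilpotent derivation kills every algebraic element: if it has index \<open>m > 0\<close> on
  \<open>e\<close>, it has index \<open>k m\<close> on \<open>e\<^sup>k\<close>, so no power of \<open>e\<close> is a combination of the lower ones.
\<close>

lemma noncommuting_imp_transcendental:
  fixes e u :: "'a::field_char_0 weyl"
  assumes "weyl_N u = UNIV" "ad u e \<noteq> 0" "(\<Sum>k<n. weyl_scale (c k) (e ^ k)) = 0" "k < n"
  shows "c k = 0"
proof -
  have "e \<noteq> 0" using assms(2) by (auto simp: ad_simps)
  then obtain m where m: "(ad u ^^ m) e \<noteq> 0" "(ad u ^^ Suc m) e = 0"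
    using nilpotency_index[of e u] assms(1) by auto
  then have "m > 0" using assms(2) by (cases m) auto
  show ?thesis using assms(3,4)
  proof (induction n arbitrary: k)
    case (Suc n)
    have low: "(ad u ^^ (n * m)) (e ^ k) = 0" if "k < n" for k
    proof (rule ad_funpow_eq_0_mono)
      show "(ad u ^^ Suc (k * m)) (e ^ k) = 0" using nilpotency_index_power[OF m] by blast
      show "Suc (k * m) \<le> n * m" using that \<open>m > 0\<close> by (simp add: Suc_le_eq)
    qed
    have "0 = (ad u ^^ (n * m)) (\<Sum>k<Suc n. weyl_scale (c k) (e ^ k))"
      by (simp only: Suc.prems ad_funpow_0)
    also have "\<dots> = weyl_scale (c n) ((ad u ^^ (n * m)) (e ^ n))"
      by (simp add: ad_funpow_add ad_funpow_sum ad_funpow_scale low)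
    finally have "c n = 0" using nilpotency_index_power[OF m, of n] by auto
    then show ?case using Suc.IH[of k] Suc.prems by (auto simp: less_Suc_eq)
  qed simp
qed

section \<open>Solvable elements\<close>

lemma canonical_pair_centralizer:
  fixes x y e :: "'a::field_char_0 weyl"
  assumes xy: "ad x y = 1" and e: "ad x e = 0" "ad y e = 0"
  shows "e \<in> weyl_scalars"
proof (rule ccontr)
  assume "e \<notin> weyl_scalars"
  then obtain u where u: "weyl_N u = UNIV" "ad u e \<noteq> 0"
    using weyl_center[of e] weyl_N_p weyl_N_q by metis
  obtain n c where c: "\<exists>k<n. \<exists>i<n. \<exists>j<n. c k i j \<noteq> 0"
    and "(\<Sum>j<n. (\<Sum>i<n. (\<Sum>k<n. weyl_scale (c k i j) (e ^ k)) * y ^ i) * x ^ j) = 0"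
    by (rule growth_dependence[of e y x])
  then have "(\<Sum>k<n. weyl_scale (c k i j) (e ^ k)) = 0" if "i < n" "j < n" for i j
    using that
    by (intro canonical_pair_independence[OF xy, of "\<lambda>i j. \<Sum>k<n. weyl_scale (c k i j) (e ^ k)" n i j])
       (auto simp: ad_sum ad_scale ad_power_commuting e)
  moreover obtain k i j where "k < n" "i < n" "j < n" "c k i j \<noteq> 0" using c by blast
  ultimately show False using noncommuting_imp_transcendental[OF u, of "\<lambda>k. c k i j" n k] by simp
qed

text \<open>
  The summand \<open>b\<^sub>k z\<^sup>k\<close> lies in the generalized eigenspace of \<open>ad x\<close> for the eigenvalue \<open>k l\<close>, and these
  eigenvalues are pairwise different. A power of \<open>S = ad x - n l\<close> therefore removes the summand for
  \<open>k = n\<close>, while on the coefficients of the others it acts as a power of the operator \<open>T k\<close>, which is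
  injective on \<open>N(x)\<close>.
\<close>

lemma eigenvector_independence:
  fixes x z :: "'a::field_char_0 weyl"
  assumes z: "ad x z = weyl_scale l z" "l \<noteq> 0" "z \<noteq> 0"
    and "\<And>k. b k \<in> weyl_N x" "(\<Sum>k<n. b k * z ^ k) = 0" "k < n"
  shows "b k = 0"
  using assms(4-)
proof (induction n arbitrary: b k)
  case (Suc n)
  have zpow: "ad x (z ^ k) = weyl_scale (of_nat k * l) (z ^ k)" for k
    by (induction k) (simp_all add: ad_simps z weyl_scale_mult weyl.scale_left_distrib distrib_right)
  define T where "T k a = ad x a + weyl_scale ((of_nat k - of_nat n) * l) a" for k a
  define S where "S a = ad x a - weyl_scale (of_nat n * l) a" for a
  have S: "S (\<Sum>k<Suc n. f k * z ^ k) = (\<Sum>k<Suc n. T k (f k) * z ^ k)" for f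
    unfolding S_def T_def ad_sum weyl.scale_sum_right sum_subtractf[symmetric]
    by (intro sum.cong refl)
       (simp add: ad_simps zpow weyl_scale_mult algebra_simps weyl.scale_left_diff_distrib)
  have TN: "(T k ^^ m) a \<in> weyl_N x" if "a \<in> weyl_N x" for k m a
    by (induction m) (auto simp: that T_def intro!: weyl_N_add weyl_N_ad weyl_N_scale)
  have T_inj: "a = 0" if "a \<in> weyl_N x" "(T k ^^ m) a = 0" "k < n" for k m a
    using that(2)
  proof (induction m)
    case (Suc m)
    define w where "w = (T k ^^ m) a"
    have "T k w = 0" using Suc.prems by (simp add: w_def)
    then have "ad x w = weyl_scale ((of_nat n - of_nat k) * l) w"
      by (simp add: T_def add_eq_0_iff2 left_diff_distrib weyl.scale_left_diff_distrib)
    from locally_nilpotent_eigenvector[OF TN[OF that(1)] this[unfolded w_def]] show ?case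
      using Suc.IH that(3) z(2) by simp
  qed simp
  have Tn: "T n = ad x" by (simp add: T_def fun_eq_iff)
  obtain m where m: "(ad x ^^ m) (b n) = 0" using Suc.prems(1)[of n] by (auto simp: weyl_N_iff)
  have Sm: "(S ^^ m) (\<Sum>k<Suc n. b k * z ^ k) = (\<Sum>k<Suc n. (T k ^^ m) (b k) * z ^ k)" for m
    by (induction m) (simp_all only: funpow.simps o_apply S id_apply)
  have "(S ^^ m) 0 = 0" by (induction m) (simp_all add: S_def ad_simps)
  then have "(\<Sum>k<n. (T k ^^ m) (b k) * z ^ k) = 0"
    using Sm[of m] Suc.prems(2) m by (simp add: Tn)
  then have "(T k ^^ m) (b k) = 0" if "k < n" for k
    using Suc.IH[of "\<lambda>k. (T k ^^ m) (b k)" k] TN Suc.prems(1) that by blast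
  then have low: "b k = 0" if "k < n" for k using T_inj Suc.prems(1) that by blast
  then have "b n * z ^ n = 0" using Suc.prems(2) by simp
  then have "b n = 0" using z(3) by simp
  then show ?case using low Suc.prems(3) by (auto simp: less_Suc_eq)
qed simp

lemma solvable_no_eigenvector:
  fixes x y z :: "'a::field_char_0 weyl"
  assumes xy: "ad x y = 1" and z: "ad x z = weyl_scale l z" "l \<noteq> 0"
  shows "z = 0"
proof (rule ccontr)
  assume "z \<noteq> 0"
  obtain n c where c: "\<exists>i<n. \<exists>j<n. \<exists>k<n. c i j k \<noteq> 0"
    and sum0: "(\<Sum>k<n. (\<Sum>j<n. (\<Sum>i<n. weyl_scale (c i j k) (y ^ i)) * x ^ j) * z ^ k) = 0"
    by (rule growth_dependence[of y x z])
  have "(\<Sum>j<n. (\<Sum>i<n. weyl_scale (c i j k) (y ^ i)) * x ^ j) = 0" if "k < n" for k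
    by (rule eigenvector_independence[OF z \<open>z \<noteq> 0\<close> _ sum0 that])
       (intro weyl_N_sum weyl_N_mult weyl_N_scale weyl_N_power weyl_N_slice[OF xy] weyl_N_commuting,
        simp add: ad_simps)
  then have "(\<Sum>j<n. (\<Sum>i<n. weyl_scale (c i j k) 1 * y ^ i) * x ^ j) = 0" if "k < n" for k
    using that by (simp add: weyl_scale_mult)
  then have "weyl_scale (c i j k) (1 :: 'a weyl) = 0" if "i < n" "j < n" "k < n" for i j k
    using canonical_pair_independence[OF xy, of "\<lambda>i j. weyl_scale (c i j k) 1" n i j] that
    by (auto simp: ad_scale ad_simps)
  then show False using c by auto
qed

text \<open>
  The induction on the nilpotency index behind \<open>A = C(x)[y]\<close> for locally nilpotent \<open>ad x\<close>: with
  \<open>d = (ad x)\<^sup>n a\<close> in \<open>C(x)\<close>, subtracting \<open>d y\<^sup>n / n!\<close> from \<open>a\<close> lowers the index. The ambient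
  space \<open>M\<close> lets the same argument run inside the centralizer of another element.
\<close>

lemma slice_decomposition:
  fixes x y :: "'a::field_char_0 weyl"
  assumes xy: "ad x y = 1"
    and M: "weyl.subspace M" "\<And>a. a \<in> M \<Longrightarrow> a * y \<in> M" "\<And>a. a \<in> M \<Longrightarrow> ad x a \<in> M"
    and R: "weyl.subspace R" "\<And>a. a \<in> R \<Longrightarrow> a * y \<in> R"
    and constants: "\<And>a. a \<in> M \<Longrightarrow> ad x a = 0 \<Longrightarrow> a \<in> R"
    and a: "a \<in> M" "a \<in> weyl_N x"
  shows "a \<in> R"
proof -
  obtain n where "(ad x ^^ n) a = 0" using a(2) by (auto simp: weyl_N_iff)
  then show ?thesis using a(1)
  proof (induction n arbitrary: a)
    case 0
    then show ?case using weyl.subspace_0[OF R(1)] by simp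
  next
    case (Suc n)
    define d where "d = (ad x ^^ n) a"
    have adM: "(ad x ^^ k) a \<in> M" for k by (induction k) (auto simp: Suc.prems M)
    have d: "d \<in> M" "ad x d = 0" using Suc.prems adM by (simp_all add: d_def)
    define t where "t = weyl_scale (inverse (fact n)) (d * y ^ n)"
    have My: "b * y ^ k \<in> M" if "b \<in> M" for b k
      by (induction k) (auto simp: that M power_Suc2 mult.assoc[symmetric] simp del: power_Suc)
    have Ry: "b * y ^ k \<in> R" if "b \<in> R" for b k
      by (induction k) (auto simp: that R power_Suc2 mult.assoc[symmetric] simp del: power_Suc)
    have "(ad x ^^ k) (d * y ^ k) = weyl_scale (fact k) d" for k
    proof (induction k)
      case (Suc k)
      have "ad x (d * y ^ Suc k) = of_nat (Suc k) * (d * y ^ k)"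
        by (simp only: ad_simps d ad_power[OF xy] of_nat_mult_eq_weyl_scale)
           (simp add: weyl_scale_mult)
      then have "(ad x ^^ Suc k) (d * y ^ Suc k) = (ad x ^^ k) (of_nat (Suc k) * (d * y ^ k))"
        by (simp only: funpow_Suc_right o_apply)
      then show ?case
        by (simp only: ad_funpow_of_nat_mult Suc)
           (simp add: of_nat_mult_eq_weyl_scale mult.commute del: of_nat_Suc)
    qed simp
    then have "(ad x ^^ n) (a - t) = 0"
      by (simp add: t_def ad_funpow_diff ad_funpow_scale d_def[symmetric])
    moreover have "a - t \<in> M"
      unfolding t_def by (intro weyl.subspace_diff weyl.subspace_scale M My d Suc.prems)
    ultimately have "a - t \<in> R" by (rule Suc.IH)
    moreover have "t \<in> R"
      unfolding t_def by (intro weyl.subspace_scale R Ry constants d)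
    ultimately show ?case using weyl.subspace_add[OF R(1), of "a - t" t] by simp
  qed
qed

section \<open>Endomorphisms\<close>

text \<open>
  The universal property: a homomorphism on the free algebra is given by the images of the generators,
  and it factors through \<open>A\<close> as soon as it kills the relator.
\<close>

fun gen_val :: "'a::field weyl \<Rightarrow> 'a weyl \<Rightarrow> gen \<Rightarrow> 'a weyl" where
  "gen_val x y GenP = x"
| "gen_val x y GenQ = y"

definition word_val :: "'a::field weyl \<Rightarrow> 'a weyl \<Rightarrow> gen_word \<Rightarrow> 'a weyl" where
  "word_val x y w = prod_list (map (gen_val x y) (letters w))"

definition free_val :: "'a::field weyl \<Rightarrow> 'a weyl \<Rightarrow> (gen_word \<Rightarrow>\<^sub>0 'a) \<Rightarrow> 'a weyl" where
  "free_val x y u = (\<Sum>w\<in>Poly_Mapping.keys u. weyl_scale (Poly_Mapping.lookup u w) (word_val x y w))"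

lemma word_val_plus: "word_val x y (u + v) = word_val x y u * word_val x y v"
  by (simp add: word_val_def plus_gen_word_def)

lemma free_val_add: "free_val x y (u + v) = free_val x y u + free_val x y v"
proof -
  let ?S = "Poly_Mapping.keys u \<union> Poly_Mapping.keys v"
  have "free_val x y t = (\<Sum>w\<in>?S. weyl_scale (Poly_Mapping.lookup t w) (word_val x y w))"
    if "Poly_Mapping.keys t \<subseteq> ?S" for t
    unfolding free_val_def using that by (intro sum.mono_neutral_left) (auto simp: in_keys_iff)
  then show ?thesis
    using Poly_Mapping.keys_add[of u v]
    by (simp add: lookup_add weyl.scale_left_distrib sum.distrib)
qed

lemma free_val_single: "free_val x y (Poly_Mapping.single w c) = weyl_scale c (word_val x y w)"
  by (simp add: free_val_def)

lemma free_val_zero: "free_val x y 0 = 0"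
  by (simp add: free_val_def)

lemma free_val_one: "free_val x y 1 = 1"
proof -
  have "word_val x y 0 = 1" by (simp add: word_val_def zero_gen_word_def)
  then show ?thesis using free_val_single[of x y 0 1] by simp
qed

lemma free_val_diff: "free_val x y (u - v) = free_val x y u - free_val x y v"
  using free_val_add[of x y "u - v" v] by simp

lemma free_val_mult: "free_val x y (u * v) = free_val x y u * free_val x y v"
proof (induction u rule: poly_mapping_single_induct)
  case (single_add s c u)
  have "free_val x y (Poly_Mapping.single s c * v) = free_val x y (Poly_Mapping.single s c) * free_val x y v"
    by (induction v rule: poly_mapping_single_induct)
       (simp_all add: free_val_zero distrib_left free_val_add mult_single free_val_single
         weyl_scale_mult word_val_plus)
  with single_add show ?case by (simp add: distrib_right free_val_add)
qed (simp add: free_val_zero)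

lemma free_val_gen: "free_val x y (free_gen g) = gen_val x y g"
  by (simp add: free_gen_def free_val_single word_val_def)

lemma free_val_ideal: "u \<in> weyl_ideal \<Longrightarrow> ad x y = 1 \<Longrightarrow> free_val x y u = 0"
  by (induction rule: weyl_ideal.induct)
     (simp_all add: free_val_zero free_val_one free_val_add free_val_diff free_val_mult
       free_val_gen ad_def)

lemma canonical_pair_endomorphism:
  fixes x y :: "'a::field weyl"
  assumes "ad x y = 1"
  obtains \<phi> where "weyl_endomorphism \<phi>" "\<phi> weyl_p = x" "\<phi> weyl_q = y"
proof
  define \<phi> where "\<phi> a = free_val x y (rep_weyl a)" for a
  have \<phi>: "\<phi> (abs_weyl u) = free_val x y u" for u
  proof -
    have "weyl_eq (rep_weyl (abs_weyl u)) u"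
      using Quotient_rep_abs[OF Quotient_weyl] equivp_reflp[OF equivp_weyl_eq] by metis
    then have "free_val x y (rep_weyl (abs_weyl u) - u) = 0"
      using free_val_ideal[OF _ assms] by (simp add: weyl_eq_def)
    then show ?thesis by (simp add: \<phi>_def free_val_diff)
  qed
  have abs: "\<exists>u. a = abs_weyl u" for a :: "'a weyl"
    by (metis Quotient_weyl Quotient_abs_rep)
  have "\<phi> (a + b) = \<phi> a + \<phi> b" "\<phi> (a * b) = \<phi> a * \<phi> b" for a b
    using abs[of a] abs[of b]
    by (auto simp: plus_weyl.abs_eq times_weyl.abs_eq \<phi> free_val_add free_val_mult)
  moreover have "\<phi> (weyl_scale c a) = weyl_scale c (\<phi> a)" for c a
    using abs[of a] free_val_single[of x y 0 c]
    by (auto simp: weyl_scale.abs_eq \<phi> free_val_mult word_val_def zero_gen_word_def weyl_scale_mult)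
  moreover have "\<phi> 1 = 1" by (simp add: one_weyl_def \<phi> free_val_one)
  ultimately show "weyl_endomorphism \<phi>"
    unfolding weyl_endomorphism_def Vector_Spaces.linear_iff
    using weyl.vector_space_axioms by blast
  show "\<phi> weyl_p = x" "\<phi> weyl_q = y"
    by (simp_all add: weyl_p_def weyl_q_def \<phi> free_val_gen)
qed

context
  fixes \<phi> :: "'a::field weyl \<Rightarrow> 'a weyl"
  assumes endo: "weyl_endomorphism \<phi>"
begin

lemma endomorphism_simps:
  "\<phi> (a + b) = \<phi> a + \<phi> b" "\<phi> (a * b) = \<phi> a * \<phi> b" "\<phi> (weyl_scale c a) = weyl_scale c (\<phi> a)"
  "\<phi> 1 = 1" "\<phi> 0 = 0" "\<phi> (a - b) = \<phi> a - \<phi> b" "\<phi> (a ^ n) = \<phi> a ^ n" "\<phi> (ad a b) = ad (\<phi> a) (\<phi> b)"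
  "\<phi> (sum f S) = (\<Sum>i\<in>S. \<phi> (f i))"
proof -
  have add: "\<phi> (a + b) = \<phi> a + \<phi> b" and mult: "\<phi> (a * b) = \<phi> a * \<phi> b"
    and scale: "\<phi> (weyl_scale c a) = weyl_scale c (\<phi> a)" and one: "\<phi> 1 = 1" for a b c
    using endo by (simp_all add: weyl_endomorphism_def Vector_Spaces.linear_iff)
  have zero: "\<phi> 0 = 0" using add[of 0 0] by simp
  have diff: "\<phi> (a - b) = \<phi> a - \<phi> b" for a b using add[of "a - b" b] by simp
  have "\<phi> (a ^ n) = \<phi> a ^ n" by (induction n) (simp_all add: one mult)
  moreover have "\<phi> (ad a b) = ad (\<phi> a) (\<phi> b)" by (simp add: ad_def diff mult)
  moreover have "\<phi> (sum f S) = (\<Sum>i\<in>S. \<phi> (f i))"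
    by (induction S rule: infinite_finite_induct) (simp_all add: zero add)
  ultimately show "\<phi> (a + b) = \<phi> a + \<phi> b" "\<phi> (a * b) = \<phi> a * \<phi> b"
    "\<phi> (weyl_scale c a) = weyl_scale c (\<phi> a)" "\<phi> 1 = 1" "\<phi> 0 = 0" "\<phi> (a - b) = \<phi> a - \<phi> b"
    "\<phi> (a ^ n) = \<phi> a ^ n" "\<phi> (ad a b) = ad (\<phi> a) (\<phi> b)" "\<phi> (sum f S) = (\<Sum>i\<in>S. \<phi> (f i))"
    by (simp_all add: add mult scale one zero diff)
qed

lemma endomorphism_canonical_pair: "ad (\<phi> weyl_p) (\<phi> weyl_q) = 1"
  using endomorphism_simps(8)[of weyl_p weyl_q] by (simp add: ad_weyl_p_q endomorphism_simps)

lemma endomorphism_weyl_N: "\<phi> a \<in> weyl_N (\<phi> x)" if "a \<in> weyl_N x"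
proof -
  have "(ad (\<phi> x) ^^ n) (\<phi> a) = \<phi> ((ad x ^^ n) a)" for n
    by (induction n) (simp_all add: endomorphism_simps)
  then show ?thesis using that endomorphism_simps(5) by (auto simp: weyl_N_iff) metis
qed

end

lemma endomorphism_inj:
  fixes \<phi> :: "'a::field_char_0 weyl \<Rightarrow> 'a weyl"
  assumes "weyl_endomorphism \<phi>"
  shows "inj \<phi>"
proof (rule injI)
  fix a b assume "\<phi> a = \<phi> b"
  note hom = endomorphism_simps[OF assms]
  obtain n c where ab: "a - b = (\<Sum>j<n. (\<Sum>i<n. weyl_scale (c i j) (weyl_q ^ i)) * weyl_p ^ j)"
    using weyl_normal_form by blast
  have "0 = \<phi> (a - b)" using \<open>\<phi> a = \<phi> b\<close> by (simp add: hom)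
  also have "\<dots> = (\<Sum>j<n. (\<Sum>i<n. weyl_scale (c i j) 1 * \<phi> weyl_q ^ i) * \<phi> weyl_p ^ j)"
    by (simp add: ab hom weyl_scale_mult)
  finally have "weyl_scale (c i j) (1 :: 'a weyl) = 0" if "i < n" "j < n" for i j
    using canonical_pair_independence[OF endomorphism_canonical_pair[OF assms],
        of "\<lambda>i j. weyl_scale (c i j) 1" n i j] that
    by (simp add: ad_scale ad_simps)
  then show "a = b" using ab by simp
qed

lemma endomorphism_surj:
  fixes \<phi> :: "'a::field_char_0 weyl \<Rightarrow> 'a weyl"
  assumes endo: "weyl_endomorphism \<phi>"
    and N: "weyl_N (\<phi> weyl_p) = UNIV" "weyl_N (\<phi> weyl_q) = UNIV"
  shows "surj \<phi>"
proof -
  note hom = endomorphism_simps[OF endo]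
  define x y where "x = \<phi> weyl_p" and "y = \<phi> weyl_q"
  have xy: "ad x y = 1" unfolding x_def y_def by (rule endomorphism_canonical_pair[OF endo])
  let ?R = "range \<phi>"
  have R: "weyl.subspace ?R"
  proof (rule weyl.subspaceI)
    show "0 \<in> ?R" by (rule range_eqI[of _ _ 0]) (simp add: hom)
    show "a + b \<in> ?R" if "a \<in> ?R" "b \<in> ?R" for a b using that by (auto simp flip: hom(1))
    show "weyl_scale c a \<in> ?R" if "a \<in> ?R" for c a using that by (auto simp flip: hom(3))
  qed
  have mult: "a * b \<in> ?R" if "a \<in> ?R" "b \<in> ?R" for a b
    using that by (auto simp flip: hom(2))
  have scalars: "e \<in> ?R" if "e \<in> weyl_scalars" for e
  proof -
    have "1 \<in> ?R" by (rule range_eqI[of _ _ 1]) (simp add: hom)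
    then show ?thesis using that weyl.subspace_scale[OF R] by (auto simp: weyl_scalars_def)
  qed
  have C: "weyl.subspace {a. ad x a = 0}"
    by (rule weyl.subspaceI) (auto simp: ad_simps ad_scale)
  \<comment> \<open>Inside \<open>C(x)\<close> the derivation \<open>ad (- y)\<close> has the slice \<open>x\<close> and the constants
    \<open>C(x) \<inter> C(y)\<close>, which are scalars.\<close>
  have centralizer: "a \<in> ?R" if "ad x a = 0" for a
  proof (rule slice_decomposition[OF ad_swapped_slice[OF xy] C _ _ R])
    show "b * x \<in> {a. ad x a = 0}" if "b \<in> {a. ad x a = 0}" for b
      using that by (simp add: ad_simps)
    show "ad (- y) b \<in> {a. ad x a = 0}" if "b \<in> {a. ad x a = 0}" for b
      using that ad_funpow_centralizer[of x y b 1] xy by (simp add: ad_uminus_left ad_uminus_right)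
    show "b * x \<in> ?R" if "b \<in> ?R" for b using that mult by (simp add: x_def)
    show "b \<in> ?R" if "b \<in> {a. ad x a = 0}" "ad (- y) b = 0" for b
      using that by (intro scalars canonical_pair_centralizer[OF xy]) (auto simp: ad_uminus_left)
  qed (use that N in \<open>auto simp: weyl_N_uminus y_def\<close>)
  have "a \<in> ?R" for a
    by (rule slice_decomposition[OF xy weyl.subspace_UNIV _ _ R])
       (use mult centralizer N in \<open>auto simp: x_def y_def\<close>)
  then show ?thesis by blast
qed

section \<open>Extension of scalars\<close>

lemma inj_of_nat_alg_closure: "inj (of_nat :: nat \<Rightarrow> 'a::field_char_0 alg_closure)"
proof (rule injI)
  fix m n assume "of_nat m = (of_nat n :: 'a alg_closure)"
  then have "to_ac (of_nat m :: 'a) = to_ac (of_nat n)" by simp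
  then have "(of_nat m :: 'a) = of_nat n" by (rule injD[OF inj_to_ac])
  then show "m = n" by simp
qed

instance alg_closure :: (field_char_0) field_char_0
  by standard (rule inj_of_nat_alg_closure)

lemma weyl_ext_simps:
  "weyl_ext (a + b) = weyl_ext a + weyl_ext b" "weyl_ext (a - b) = weyl_ext a - weyl_ext b"
  "weyl_ext (a * b) = weyl_ext a * weyl_ext b" "weyl_ext 0 = 0" "weyl_ext 1 = 1"
  "weyl_ext (weyl_scale c a) = weyl_scale (to_ac c) (weyl_ext a)"
  "weyl_ext weyl_p = weyl_p" "weyl_ext weyl_q = weyl_q"
  by (transfer; simp add: free_ext_add free_ext_diff free_ext_mult free_ext_zero free_ext_one
      free_ext_single free_gen_def weyl_eq_def weyl_ideal.zero)+

lemma weyl_ext_ad: "weyl_ext (ad a b) = ad (weyl_ext a) (weyl_ext b)"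
  by (simp add: ad_def weyl_ext_simps)

lemma weyl_ext_power: "weyl_ext (a ^ n) = weyl_ext a ^ n"
  by (induction n) (simp_all add: weyl_ext_simps)

lemma weyl_ext_sum: "weyl_ext (sum f S) = (\<Sum>i\<in>S. weyl_ext (f i))"
  by (induction S rule: infinite_finite_induct) (simp_all add: weyl_ext_simps)

text \<open>
  Extension of scalars acts on the coefficients of the normal form, and the normal form over the
  closure is unique.
\<close>

lemma weyl_ext_eq_0:
  fixes a :: "'a::field_char_0 weyl"
  shows "weyl_ext a = 0 \<longleftrightarrow> a = 0"
proof
  assume "weyl_ext a = 0"
  obtain n c where a: "a = (\<Sum>j<n. (\<Sum>i<n. weyl_scale (c i j) (weyl_q ^ i)) * weyl_p ^ j)"
    using weyl_normal_form by blast
  have "0 = weyl_ext a" using \<open>weyl_ext a = 0\<close> by simp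
  also have "\<dots> = (\<Sum>j<n. (\<Sum>i<n. weyl_scale (to_ac (c i j)) 1 * weyl_q ^ i) * weyl_p ^ j)"
    by (simp add: a weyl_ext_sum weyl_ext_simps weyl_ext_power weyl_scale_mult)
  finally have "weyl_scale (to_ac (c i j)) (1 :: 'a alg_closure weyl) = 0" if "i < n" "j < n" for i j
    using canonical_pair_independence[OF ad_weyl_p_q, of "\<lambda>i j. weyl_scale (to_ac (c i j)) 1" n i j] that
    by (simp add: ad_scale ad_simps)
  then have "c i j = 0" if "i < n" "j < n" for i j
    using that injD[OF inj_to_ac, of "c i j" 0] by simp
  then show "a = 0" using a by simp
qed (simp add: weyl_ext_simps)

lemma solvable_weyl_D_eq_weyl_C:
  fixes x :: "'a::field_char_0 weyl"
  assumes "weyl_solvable x"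
  shows "weyl_D x = weyl_C x"
proof
  obtain y where "ad x y = 1" using assms by (auto simp: weyl_solvable_def)
  then have xy: "ad (weyl_ext x) (weyl_ext y) = 1"
    by (simp add: weyl_ext_simps flip: weyl_ext_ad)
  show "weyl_D x \<subseteq> weyl_C x"
  proof
    fix z assume "z \<in> weyl_D x"
    then obtain l where l: "ad (weyl_ext x) (weyl_ext z) = weyl_scale l (weyl_ext z)"
      by (auto simp: weyl_D_def)
    then have "l = 0 \<or> weyl_ext z = 0" using solvable_no_eigenvector[OF xy] by blast
    then have "weyl_ext (ad x z) = 0" using l by (auto simp: weyl_ext_ad)
    then show "z \<in> weyl_C x" by (simp add: weyl_ext_eq_0 weyl_C_def)
  qed
  show "weyl_C x \<subseteq> weyl_D x"
    by (auto simp: weyl_C_def weyl_D_def weyl_ext_simps intro!: exI[of _ 0] simp flip: weyl_ext_ad)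
qed

lemma solvable_Delta:
  fixes x :: "'a::field_char_0 weyl"
  assumes "weyl_solvable x"
  shows "x \<in> Delta1 \<longleftrightarrow> weyl_N x = UNIV" and "x \<in> Delta2 \<longleftrightarrow> weyl_N x \<noteq> UNIV"
proof -
  obtain y where xy: "ad x y = 1" using assms by (auto simp: weyl_solvable_def)
  have "x \<notin> weyl_scalars" using xy by (auto simp: weyl_scalars_def ad_def weyl_scale_mult)
  moreover have "weyl_N x \<noteq> weyl_C x" using weyl_N_slice[OF xy] xy by (auto simp: weyl_C_def)
  ultimately show "x \<in> Delta1 \<longleftrightarrow> weyl_N x = UNIV" and "x \<in> Delta2 \<longleftrightarrow> weyl_N x \<noteq> UNIV"
    using solvable_weyl_D_eq_weyl_C[OF assms] by (auto simp: Delta1_def Delta2_def)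
qed

theorem theorem3p8:
  shows "((\<forall>\<phi> :: 'a::field_char_0 weyl \<Rightarrow> 'a weyl. weyl_endomorphism \<phi> \<longrightarrow> weyl_automorphism \<phi>)
            \<longleftrightarrow> (\<forall>x :: 'a weyl. weyl_solvable x \<longrightarrow> strictly_nilpotent x))
       \<and> ((\<forall>x :: 'a weyl. weyl_solvable x \<longrightarrow> strictly_nilpotent x)
            \<longleftrightarrow> (\<forall>x \<in> (Delta2 :: 'a weyl set). \<not> weyl_solvable x))"
proof (intro conjI iffI allI impI)
  fix x :: "'a weyl"
  assume auto: "\<forall>\<phi> :: 'a weyl \<Rightarrow> 'a weyl. weyl_endomorphism \<phi> \<longrightarrow> weyl_automorphism \<phi>"
    and x: "weyl_solvable x"
  then obtain y where "ad x y = 1" by (auto simp: weyl_solvable_def)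
  then obtain \<phi> where \<phi>: "weyl_endomorphism \<phi>" "\<phi> weyl_p = x"
    by (rule canonical_pair_endomorphism)
  then have "surj \<phi>" using auto by (auto simp: weyl_automorphism_def bij_is_surj)
  then have "a \<in> weyl_N x" for a
    using endomorphism_weyl_N[OF \<phi>(1), of _ weyl_p] \<phi>(2) weyl_N_p by (metis UNIV_I surjD)
  then show "strictly_nilpotent x" using solvable_Delta(1)[OF x] by (auto simp: strictly_nilpotent_def)
next
  fix \<phi> :: "'a weyl \<Rightarrow> 'a weyl"
  assume nil: "\<forall>x :: 'a weyl. weyl_solvable x \<longrightarrow> strictly_nilpotent x"
    and \<phi>: "weyl_endomorphism \<phi>"
  have pq: "ad (\<phi> weyl_p) (\<phi> weyl_q) = 1" by (rule endomorphism_canonical_pair[OF \<phi>])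
  have N: "weyl_N x = UNIV" if "ad x y = 1" for x y :: "'a weyl"
    using nil that solvable_Delta(1)[of x] by (auto simp: weyl_solvable_def strictly_nilpotent_def)
  have "weyl_N (\<phi> weyl_q) = UNIV" using N[OF ad_swapped_slice[OF pq]] by (simp add: weyl_N_uminus)
  then show "weyl_automorphism \<phi>"
    using endomorphism_surj[OF \<phi> N[OF pq]] endomorphism_inj[OF \<phi>] \<phi>
    by (simp add: weyl_automorphism_def bij_def)
next
  assume nil: "\<forall>x :: 'a weyl. weyl_solvable x \<longrightarrow> strictly_nilpotent x"
  show "\<forall>x \<in> (Delta2 :: 'a weyl set). \<not> weyl_solvable x"
    using nil solvable_Delta unfolding strictly_nilpotent_def by metis
next
  fix x :: "'a weyl"
  assume "\<forall>x \<in> (Delta2 :: 'a weyl set). \<not> weyl_solvable x" "weyl_solvable x"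
  then show "strictly_nilpotent x" using solvable_Delta unfolding strictly_nilpotent_def by metis
qed

end
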